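(* Assume that $\sum_{n\ge1}\beta_n^\alpha/\gamma_n<\infty$ and that $F:H\to H$ is Lipschitz continuous and bounded. Then, for any $x\in H$, the mild solution $X=(X_t^x)$ to the equation $$dX_t=AX_t\,dt+F(X_t)\,dt+dZ_t,\qquad X_0=x,$$ is irreducible, i.e. $\mathbb P(X_t^x\in B)>0$ for any open ball $B\subset H$ and any $t>0$.
   Context: Let $H$ be a real separable (infinite-dimensional) Hilbert space with a fixed orthonormal basis $(e_n)_{n\ge1}$. Fix $\alpha\in(0,2)$. $(Z^n_t)_{t\ge0}$, $n\ge1$, are independent real normalized symmetric $\alpha$-stable Lévy processes, $\mathbb E[e^{ihZ^n_t}]=e^{-t|h|^\alpha}$, on a stochastic basis $(\Omega,\mathcal F,(\mathcal F_t)_{t\ge0},\mathbb P)$ satisfying the usual assumptions (adapted, with the increments of $(Z^n)_{n\ge 1}$ after time $s$ independent of $\mathcal F_s$). $(\beta_n)$ is a sequence of positive reals, $Z_t=\sum_n\beta_nZ_t^ne_n$ (a cylindrical $\alpha$-stable process). $A:D(A)\subset H\to H$ is self-adjoint with $e_n\in D(A)$, $Ae_n=-\gamma_ne_n$, $\gamma_n>0$ for all $n\ge 1$, and $\gamma_n\to+\infty$; $e^{tA}e_k=e^{-\gamma_kt}e_k$. Set $Z_A(t)=\int_0^te^{(t-s)A}dZ_s=\sum_{n\ge1}\big(\int_0^te^{-\gamma_n(t-s)}\beta_n\,dZ_s^n\big)e_n$, which is $H$-valued under $\sum_n\beta_n^\alpha/\gamma_n<\infty$ and has a predictable version, which is the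 one used. The mild solution (which exists and is unique up to modification) is the predictable $H$-valued process $X=(X_t^x)$ such that for any $t\ge0$, $\mathbb P$-a.s., $X_t^x=e^{tA}x+\int_0^te^{(t-s)A}F(X_s^x)\,ds+Z_A(t)$. *)

theory Defs
  imports "HOL-Probability.Probability"
begin

section \<open>Hilbert space and semigroup\<close>

definition orthonormal_basis :: "(nat \<Rightarrow> 'h::real_inner) \<Rightarrow> bool" where
  "orthonormal_basis e \<longleftrightarrow>
     (\<forall>i j. e i \<bullet> e j = (if i = j then 1 else 0)) \<and> closure (span (range e)) = UNIV"

text \<open>An unbounded operator is a total function \<open>A\<close> together with its domain \<open>D\<close>; the values of
  \<open>A\<close> outside \<open>D\<close> are irrelevant. The last clause says that the graph of the adjoint of \<open>A\<close>
  coincides with the graph of \<open>A\<close>, so that in particular the two domains agree.\<close>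

definition self_adjoint :: "'h::real_inner set \<Rightarrow> ('h \<Rightarrow> 'h) \<Rightarrow> bool" where
  "self_adjoint D A \<longleftrightarrow>
     subspace D \<and> closure D = UNIV \<and>
     (\<forall>x\<in>D. \<forall>y\<in>D. A (x + y) = A x + A y) \<and>
     (\<forall>c. \<forall>x\<in>D. A (c *\<^sub>R x) = c *\<^sub>R A x) \<and>
     (\<forall>y z. (\<forall>x\<in>D. A x \<bullet> y = x \<bullet> z) \<longleftrightarrow> (y \<in> D \<and> z = A y))"

text \<open>Time is \<^typ>\<open>real\<close>; only times \<open>t \<ge> 0\<close> are constrained, here and below.\<close>

definition C0_semigroup :: "(real \<Rightarrow> 'h::real_normed_vector \<Rightarrow> 'h) \<Rightarrow> bool" where
  "C0_semigroup S \<longleftrightarrow>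
     (\<forall>t\<ge>0. bounded_linear (S t)) \<and>
     (\<forall>x. S 0 x = x) \<and>
     (\<forall>s\<ge>0. \<forall>t\<ge>0. \<forall>x. S (s + t) x = S s (S t x)) \<and>
     (\<forall>x. ((\<lambda>t. S t x) \<longlongrightarrow> x) (at_right 0))"

text \<open>\<open>S t\<close> is \<open>exp (t A)\<close>: the operator \<open>A\<close> with domain \<open>D\<close> is the infinitesimal generator
  of \<open>S\<close>.\<close>

definition generates_semigroup ::
  "'h::real_normed_vector set \<Rightarrow> ('h \<Rightarrow> 'h) \<Rightarrow> (real \<Rightarrow> 'h \<Rightarrow> 'h) \<Rightarrow> bool" where
  "generates_semigroup D A S \<longleftrightarrow>
     C0_semigroup S \<and>
     (\<forall>x y. ((\<lambda>t. (S t x - x) /\<^sub>R t) \<longlongrightarrow> y) (at_right 0) \<longleftrightarrow> (x \<in> D \<and> y = A x))"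

section \<open>Stochastic basis and predictable processes\<close>

locale stochastic_basis = prob_space M + complete_measure M
  for M :: "'w measure" +
  fixes \<F> :: "real \<Rightarrow> 'w measure"
  assumes subalgebra_\<F>: "t \<ge> 0 \<Longrightarrow> subalgebra M (\<F> t)"
    and \<F>_mono: "0 \<le> s \<Longrightarrow> s \<le> t \<Longrightarrow> sets (\<F> s) \<subseteq> sets (\<F> t)"
    and \<F>_null_sets: "null_sets M \<subseteq> sets (\<F> 0)"
    and \<F>_right_continuous: "t \<ge> 0 \<Longrightarrow> sets (\<F> t) = (\<Inter>s\<in>{t<..}. sets (\<F> s))"

definition predictable_algebra ::
  "'w measure \<Rightarrow> (real \<Rightarrow> 'w measure) \<Rightarrow> (real \<times> 'w) measure" where
  "predictable_algebra M \<F> =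
     sigma ({0..} \<times> space M)
       ({{0} \<times> A | A. A \<in> sets (\<F> 0)} \<union>
        {{s<..t} \<times> A | s t A. 0 \<le> s \<and> s < t \<and> A \<in> sets (\<F> s)})"

definition predictable ::
  "'w measure \<Rightarrow> (real \<Rightarrow> 'w measure) \<Rightarrow> (real \<Rightarrow> 'w \<Rightarrow> 'h::topological_space) \<Rightarrow> bool" where
  "predictable M \<F> X \<longleftrightarrow> (\<lambda>(t, \<omega>). X t \<omega>) \<in> borel_measurable (predictable_algebra M \<F>)"

section \<open>Stable noise\<close>

definition levy_process :: "'w measure \<Rightarrow> (real \<Rightarrow> 'w \<Rightarrow> real) \<Rightarrow> bool" where
  "levy_process M Y \<longleftrightarrow>
     (\<forall>t\<ge>0. Y t \<in> borel_measurable M) \<and>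
     (AE \<omega> in M. Y 0 \<omega> = 0) \<and>
     (\<forall>(N::nat) \<tau>. 0 \<le> \<tau> 0 \<and> (\<forall>i<N. \<tau> i \<le> \<tau> (Suc i)) \<longrightarrow>
        prob_space.indep_vars M (\<lambda>_. borel) (\<lambda>i \<omega>. Y (\<tau> (Suc i)) \<omega> - Y (\<tau> i) \<omega>) {..<N}) \<and>
     (\<forall>s t. 0 \<le> s \<and> s \<le> t \<longrightarrow>
        distr M borel (\<lambda>\<omega>. Y t \<omega> - Y s \<omega>) = distr M borel (Y (t - s))) \<and>
     (\<forall>s\<ge>0. \<forall>\<epsilon>>0.
        ((\<lambda>t. measure M {\<omega> \<in> space M. \<bar>Y t \<omega> - Y s \<omega>\<bar> > \<epsilon>}) \<longlongrightarrow> 0) (at s within {0..})) \<and>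
     (AE \<omega> in M. \<forall>t\<ge>0. ((\<lambda>s. Y s \<omega>) \<longlongrightarrow> Y t \<omega>) (at_right t) \<and>
        (t > 0 \<longrightarrow> (\<exists>l. ((\<lambda>s. Y s \<omega>) \<longlongrightarrow> l) (at_left t))))"

definition stable_levy_process ::
  "'w measure \<Rightarrow> real \<Rightarrow> (real \<Rightarrow> 'w \<Rightarrow> real) \<Rightarrow> bool" where
  "stable_levy_process M \<alpha> Y \<longleftrightarrow>
     levy_process M Y \<and>
     (\<forall>t\<ge>0. \<forall>h. char (distr M borel (Y t)) h = complex_of_real (exp (- t * \<bar>h\<bar> powr \<alpha>)))"

text \<open>In the definition of \<open>stable_noise\<close>, independence of the processes \<open>Z 0, Z 1, \<dots>\<close> is
  independence of their paths as random elements of the product space; the last clause is joint in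
  all \<open>n\<close> and all times after \<open>s\<close>.\<close>

definition stable_noise ::
  "'w measure \<Rightarrow> (real \<Rightarrow> 'w measure) \<Rightarrow> real \<Rightarrow> (nat \<Rightarrow> real \<Rightarrow> 'w \<Rightarrow> real) \<Rightarrow> bool" where
  "stable_noise M \<F> \<alpha> Z \<longleftrightarrow>
     (\<forall>n. stable_levy_process M \<alpha> (Z n)) \<and>
     prob_space.indep_vars M (\<lambda>_. PiM {0..} (\<lambda>_. borel)) (\<lambda>n \<omega>. \<lambda>t\<in>{0..}. Z n t \<omega>) UNIV \<and>
     (\<forall>n. \<forall>t\<ge>0. Z n t \<in> borel_measurable (\<F> t)) \<and>
     (\<forall>s\<ge>0. prob_space.indep_set M (sets (\<F> s))
        (sets (vimage_algebra (space M)
           (\<lambda>\<omega>. \<lambda>p\<in>UNIV \<times> {s..}. Z (fst p) (snd p) \<omega> - Z (fst p) s \<omega>)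
           (PiM (UNIV \<times> {s..}) (\<lambda>_. borel)))))"

section \<open>Stochastic integral, stochastic convolution, mild solution\<close>

text \<open>The integral of a deterministic (continuous) \<open>f\<close> over \<open>[0,t]\<close> with respect to the real
  process \<open>Y\<close>: the limit in probability of Riemann sums as the mesh tends to 0. It is determined
  up to almost sure equality, hence a relation.\<close>

definition has_stoch_integral ::
  "'w measure \<Rightarrow> (real \<Rightarrow> real) \<Rightarrow> (real \<Rightarrow> 'w \<Rightarrow> real) \<Rightarrow> real \<Rightarrow> ('w \<Rightarrow> real) \<Rightarrow> bool" where
  "has_stoch_integral M f Y t J \<longleftrightarrow>
     J \<in> borel_measurable M \<and>
     (\<forall>\<epsilon>>0. \<forall>\<eta>>0. \<exists>\<delta>>0. \<forall>(N::nat) \<tau>.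
        \<tau> 0 = 0 \<and> \<tau> N = t \<and> (\<forall>i<N. \<tau> i \<le> \<tau> (Suc i) \<and> \<tau> (Suc i) - \<tau> i < \<delta>) \<longrightarrow>
        measure M {\<omega> \<in> space M.
          \<bar>(\<Sum>i<N. f (\<tau> i) * (Y (\<tau> (Suc i)) \<omega> - Y (\<tau> i) \<omega>)) - J \<omega>\<bar> > \<epsilon>} < \<eta>)"

text \<open>A predictable version of the convolution of \<open>exp (t A)\<close> with the cylindrical process
  \<open>\<Sum>n. \<beta> n * Z n t\<close> along \<open>e n\<close>, where \<open>A (e n) = - \<gamma> n e n\<close>; the series converges in the norm
  of the Hilbert space.\<close>

definition stoch_convolution ::
  "'w measure \<Rightarrow> (real \<Rightarrow> 'w measure) \<Rightarrow> (nat \<Rightarrow> 'h::real_normed_vector) \<Rightarrow> (nat \<Rightarrow> real) \<Rightarrow>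
   (nat \<Rightarrow> real) \<Rightarrow> (nat \<Rightarrow> real \<Rightarrow> 'w \<Rightarrow> real) \<Rightarrow> (real \<Rightarrow> 'w \<Rightarrow> 'h) \<Rightarrow> bool" where
  "stoch_convolution M \<F> e \<beta> \<gamma> Z Z\<^sub>A \<longleftrightarrow>
     predictable M \<F> Z\<^sub>A \<and>
     (\<forall>t\<ge>0. \<exists>J. (\<forall>n. has_stoch_integral M (\<lambda>s. exp (- \<gamma> n * (t - s)) * \<beta> n) (Z n) t (J n)) \<and>
        (AE \<omega> in M. (\<lambda>n. J n \<omega> *\<^sub>R e n) sums Z\<^sub>A t \<omega>))"

definition mild_solution ::
  "'w measure \<Rightarrow> (real \<Rightarrow> 'w measure) \<Rightarrow>
   (real \<Rightarrow> 'h \<Rightarrow> 'h::{real_inner, banach, second_countable_topology}) \<Rightarrow> ('h \<Rightarrow> 'h) \<Rightarrow>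
   (real \<Rightarrow> 'w \<Rightarrow> 'h) \<Rightarrow> 'h \<Rightarrow> (real \<Rightarrow> 'w \<Rightarrow> 'h) \<Rightarrow> bool" where
  "mild_solution M \<F> S F Z\<^sub>A x X \<longleftrightarrow>
     predictable M \<F> X \<and>
     (\<forall>t\<ge>0. AE \<omega> in M.
        X t \<omega> = S t x + (LINT s:{0..t}|lborel. S (t - s) (F (X s \<omega>))) + Z\<^sub>A t \<omega>)"

definition irreducible_process ::
  "'w measure \<Rightarrow> (real \<Rightarrow> 'w \<Rightarrow> 'h::metric_space) \<Rightarrow> bool" where
  "irreducible_process M X \<longleftrightarrow>
     (\<forall>t>0. \<forall>y. \<forall>r>0. measure M {\<omega> \<in> space M. X t \<omega> \<in> ball y r} > 0)"

end

theory Submission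
  imports Defs
begin

text \<open>Since \<open>F\<close> is bounded, the drift over \<open>[t - \<epsilon>, t]\<close> contributes at most \<open>\<epsilon> sup |F|\<close>, so up to a
  small error \<open>X\<^sub>t\<close> equals \<open>exp (\<epsilon> A) X\<^sub>s + W\<close> with \<open>s = t - \<epsilon>\<close> and
  \<open>W = Z\<^sub>A t - exp (\<epsilon> A) (Z\<^sub>A s)\<close>. Here \<open>W\<close> is a function of the noise increments after \<open>s\<close>, hence
  independent of \<open>X\<^sub>s\<close>, and the sum of independent variables hits every ball as soon as \<open>W\<close> does.
  The coordinates of \<open>W\<close> are independent with symmetric stable laws. Such a law has full support:
  its support is symmetric, unbounded and, by stability, closed under multiplication by scalars in
  \<open>[0, 1]\<close>.\<close>

section \<open>Orthonormal expansions\<close>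

text \<open>The drift depends on the whole history of the noise, so the law of \<open>X t\<close> is
  not explicit. Splitting at s costs an error that is uniform in \<omega>, and the law of
  \<open>X s\<close> then enters only through one support point z, which exists because the space is
  second countable; W is aimed at y - z. The delicate point is the independence of W from the past.
  The stochastic integrals are limits in probability of Riemann sums over all of [0, t], so they are
  fixed only up to null sets and refer to times before s. Because exp (- \<gamma> (t - u)) = exp (-
  \<gamma> (t - s)) exp (- \<gamma> (s - u)), the past cancels in the difference and Riemann sums
  over [s, t] remain. Along an almost surely convergent subsequence their pointwise limit is a
  measurable functional of the increments after s. Closure of the stable support under scalars k in
  [0, 1] rests on time: scaling by k turns time c into |k|^\<alpha> c, and the time left over can
  contribute the support point 0.\<close>

lemma norm_sum_orthonormal:
  fixes e :: "'i \<Rightarrow> 'h::real_inner"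
  assumes "\<And>i j. e i \<bullet> e j = (if i = j then 1 else 0)" and "finite I"
  shows "(norm (\<Sum>i\<in>I. a i *\<^sub>R e i))\<^sup>2 = (\<Sum>i\<in>I. (a i)\<^sup>2)"
  using \<open>finite I\<close> unfolding power2_norm_eq_inner
  by (simp add: inner_sum_left inner_sum_right assms(1) power2_eq_square
      if_distrib sum.delta cong: if_cong)

text \<open>Bessel's inequality: the projection \<open>p\<close> satisfies
  \<open>p \<bullet> p = h \<bullet> p\<close>, and Cauchy-Schwarz bounds the right-hand
  side.\<close>

lemma norm_orthonormal_projection_le:
  fixes e :: "'i \<Rightarrow> 'h::real_inner"
  assumes e: "\<And>i j. e i \<bullet> e j = (if i = j then 1 else 0)" and I: "finite I"
  shows "norm (\<Sum>i\<in>I. (h \<bullet> e i) *\<^sub>R e i) \<le> norm h"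
proof -
  define p where "p = (\<Sum>i\<in>I. (h \<bullet> e i) *\<^sub>R e i)"
  have "p \<bullet> p = (\<Sum>i\<in>I. (h \<bullet> e i)\<^sup>2)"
    unfolding p_def norm_sum_orthonormal[of e, OF e I, symmetric] power2_norm_eq_inner ..
  also have "\<dots> = h \<bullet> p"
    by (simp add: p_def inner_sum_right power2_eq_square)
  finally have "p \<bullet> p = h \<bullet> p" .
  hence "norm p * norm p \<le> norm h * norm p"
    using norm_cauchy_schwarz[of h p] by (simp add: power2_norm_eq_inner[symmetric] power2_eq_square)
  thus ?thesis
    unfolding p_def[symmetric] by (cases "p = 0") auto
qed

lemma orthonormal_basis_inner:
  "orthonormal_basis e \<Longrightarrow> e i \<bullet> e j = (if i = j then 1 else 0)"
  by (simp add: orthonormal_basis_def)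

text \<open>The partial sums are contractions that eventually fix every vector of the dense span, so
  their convergence there extends to the whole space.\<close>

lemma orthonormal_basis_expansion:
  fixes e :: "nat \<Rightarrow> 'h::real_inner"
  assumes e: "orthonormal_basis e"
  shows "(\<lambda>n. (h \<bullet> e n) *\<^sub>R e n) sums h"
proof -
  note on = orthonormal_basis_inner[OF e]
  define P where "P N h = (\<Sum>n<N. (h \<bullet> e n) *\<^sub>R e n)" for N h
  have P_add: "P N (v + w) = P N v + P N w" for N v w
    by (simp add: P_def inner_add_left scaleR_add_left sum.distrib)
  have P_scale: "P N (c *\<^sub>R v) = c *\<^sub>R P N v" for N c v
    by (simp add: P_def scaleR_sum_right)
  have P_span: "eventually (\<lambda>N. P N v = v) sequentially" if "v \<in> span (range e)" for v
    using that
  proof (induction rule: span_induct_alt)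
    case base
    then show ?case
      by (simp add: P_def)
  next
    case (step c v w)
    then obtain k where k: "v = e k" by auto
    have "eventually (\<lambda>N. P N v = v) sequentially"
      using eventually_gt_at_top[of k]
    proof eventually_elim
      case (elim N)
      then show ?case
        unfolding P_def k by (simp add: on if_distrib[of "\<lambda>c. c *\<^sub>R _"] sum.delta cong: if_cong)
    qed
    with step(2) show ?case
      by eventually_elim (simp add: P_add P_scale)
  qed
  have "(\<lambda>N. P N h) \<longlonglongrightarrow> h"
  proof (rule tendstoI)
    fix r :: real assume r: "r > 0"
    have "h \<in> closure (span (range e))"
      using e by (simp add: orthonormal_basis_def)
    then obtain v where v: "v \<in> span (range e)" "dist v h < r / 2"
      using r by (auto simp: closure_approachable dest!: spec[of _ "r/2"])
    show "eventually (\<lambda>N. dist (P N h) h < r) sequentially"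
      using P_span[OF v(1)]
    proof eventually_elim
      case (elim N)
      have "P N h - h = P N (h - v) + (v - h)"
        using P_add[of N "h - v" v] elim by simp
      also have "norm \<dots> \<le> norm (h - v) + norm (v - h)"
        using norm_orthonormal_projection_le[of e, OF on, of "{..<N}" "h - v"]
        by (intro norm_triangle_le) (simp add: P_def)
      finally show ?case
        using v(2) by (simp add: dist_norm norm_minus_commute)
    qed
  qed
  thus ?thesis
    by (simp add: sums_def P_def)
qed

lemma diagonal_operator_expansion:
  fixes e :: "nat \<Rightarrow> 'h::real_inner"
  assumes e: "orthonormal_basis e" and T: "bounded_linear T" and "\<And>n. T (e n) = c n *\<^sub>R e n"
  shows "(\<lambda>n. (c n * (h \<bullet> e n)) *\<^sub>R e n) sums T h"
proof -
  have "T ((h \<bullet> e n) *\<^sub>R e n) = (c n * (h \<bullet> e n)) *\<^sub>R e n" for n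
    by (subst linear_simps(5)[OF T]) (simp add: assms(3) mult.commute)
  with bounded_linear.sums[OF T orthonormal_basis_expansion[OF e, of h]] show ?thesis
    by simp
qed

text \<open>Damping each coordinate shrinks the partial sums below those of h, which Bessel's
  inequality controls. With \<open>c n\<close> = exp (- \<gamma> n \<tau>) this bounds the semigroup
  by 1.\<close>

lemma diagonal_operator_contraction:
  fixes e :: "nat \<Rightarrow> 'h::real_inner"
  assumes e: "orthonormal_basis e" and T: "bounded_linear T" "\<And>n. T (e n) = c n *\<^sub>R e n"
    and c: "\<And>n. \<bar>c n\<bar> \<le> 1"
  shows "norm (T h) \<le> norm h"
proof (rule LIMSEQ_le_const2)
  show "(\<lambda>N. norm (\<Sum>n<N. (c n * (h \<bullet> e n)) *\<^sub>R e n)) \<longlonglongrightarrow> norm (T h)"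
    using diagonal_operator_expansion[OF e T] by (intro tendsto_norm) (simp add: sums_def)
  have "norm (\<Sum>n<N. (c n * (h \<bullet> e n)) *\<^sub>R e n) \<le> norm h" for N
  proof -
    note on = orthonormal_basis_inner[OF e]
    have "(norm (\<Sum>n<N. (c n * (h \<bullet> e n)) *\<^sub>R e n))\<^sup>2 \<le> (norm (\<Sum>n<N. (h \<bullet> e n) *\<^sub>R e n))\<^sup>2"
      unfolding norm_sum_orthonormal[of e, OF on finite_lessThan]
      using c by (intro sum_mono) (simp add: power_mult_distrib mult_left_le_one_le abs_square_le_1)
    then show ?thesis
      using norm_orthonormal_projection_le[of e, OF on, of "{..<N}" h]
      by (meson finite_lessThan norm_ge_zero order_trans power2_le_imp_le)
  qed
  then show "\<exists>N. \<forall>n\<ge>N. norm (\<Sum>n<n. (c n * (h \<bullet> e n)) *\<^sub>R e n) \<le> norm h" by blast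
qed

section \<open>Support points\<close>

text \<open>Membership of y in the topological support of the law of X. Irreducibility says that for
  every t > 0 all points are support points of \<open>X t\<close>.\<close>

definition support_point :: "'w measure \<Rightarrow> ('w \<Rightarrow> 'a::metric_space) \<Rightarrow> 'a \<Rightarrow> bool" where
  "support_point M X y \<longleftrightarrow> (\<forall>r>0. measure M {\<omega> \<in> space M. X \<omega> \<in> ball y r} > 0)"

context prob_space
begin

text \<open>Otherwise every point of U has a ball of probability 0 around it; by the Lindelof
  property countably many of these cover U, and U would have probability 0.\<close>

lemma ex_support_point:
  fixes X :: "'a \<Rightarrow> 'h::{metric_space, second_countable_topology}"
  assumes [measurable]: "X \<in> borel_measurable M" and U: "open U"
    and pos: "prob {\<omega> \<in> space M. X \<omega> \<in> U} > 0"
  shows "\<exists>y\<in>U. support_point M X y"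
proof (rule ccontr)
  assume "\<not> ?thesis"
  hence "\<forall>y\<in>U. \<exists>r>0. prob {\<omega> \<in> space M. X \<omega> \<in> ball y r} = 0"
    by (auto simp: support_point_def not_less measure_le_0_iff)
  then obtain r where r: "\<And>y. y \<in> U \<Longrightarrow> r y > 0"
      "\<And>y. y \<in> U \<Longrightarrow> prob {\<omega> \<in> space M. X \<omega> \<in> ball y (r y)} = 0"
    by metis
  obtain \<B> where \<B>: "\<B> \<subseteq> (\<lambda>y. ball y (r y)) ` U" "countable \<B>"
      "\<Union>\<B> = \<Union>((\<lambda>y. ball y (r y)) ` U)"
    using Lindelof[of "(\<lambda>y. ball y (r y)) ` U"] by auto
  have "{\<omega> \<in> space M. X \<omega> \<in> B} \<in> null_sets M" if "B \<in> \<B>" for B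
  proof -
    obtain y where y: "y \<in> U" "B = ball y (r y)"
      using subsetD[OF \<B>(1) \<open>B \<in> \<B>\<close>] by blast
    show ?thesis
      using r(2)[OF y(1)] unfolding y(2) by (intro null_setsI) (auto simp: emeasure_eq_measure)
  qed
  hence "(\<Union>B\<in>\<B>. {\<omega> \<in> space M. X \<omega> \<in> B}) \<in> null_sets M"
    using \<B>(2) by (intro null_sets_UN') auto
  moreover have "U \<subseteq> \<Union>\<B>"
    unfolding \<B>(3) using r(1) by auto
  hence "{\<omega> \<in> space M. X \<omega> \<in> U} \<subseteq> (\<Union>B\<in>\<B>. {\<omega> \<in> space M. X \<omega> \<in> B})"
    by auto
  ultimately have "prob {\<omega> \<in> space M. X \<omega> \<in> U} \<le> prob (\<Union>B\<in>\<B>. {\<omega> \<in> space M. X \<omega> \<in> B})"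
    by (intro finite_measure_mono) auto
  also have "\<dots> = 0"
    by (rule measure_eq_0_null_sets) fact
  finally show False
    using pos by simp
qed

lemma support_point_add:
  fixes X Y :: "'a \<Rightarrow> 'h::{real_normed_vector, second_countable_topology}"
  assumes ind: "indep_var borel X borel Y" and "support_point M X y" "support_point M Y z"
  shows "support_point M (\<lambda>\<omega>. X \<omega> + Y \<omega>) (y + z)"
  unfolding support_point_def
proof safe
  fix r :: real assume r: "r > 0"
  have [measurable]: "X \<in> borel_measurable M" "Y \<in> borel_measurable M"
    using indep_var_rv1[OF ind] indep_var_rv2[OF ind] by auto
  have eq: "Z -` B \<inter> space M = {\<omega> \<in> space M. Z \<omega> \<in> B}" for Z :: "'a \<Rightarrow> 'h" and B
    by auto
  have "0 < prob {\<omega> \<in> space M. X \<omega> \<in> ball y (r/2)} * prob {\<omega> \<in> space M. Y \<omega> \<in> ball z (r/2)}"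
    using assms(2,3) half_gt_zero[OF r] unfolding support_point_def by (blast intro: mult_pos_pos)
  also have "\<dots> = prob ((\<lambda>\<omega>. (X \<omega>, Y \<omega>)) -` (ball y (r/2) \<times> ball z (r/2)) \<inter> space M)"
    by (subst indep_varD[OF ind]) (auto simp only: eq borel_open open_ball)
  also have "\<dots> \<le> prob {\<omega> \<in> space M. X \<omega> + Y \<omega> \<in> ball (y + z) r}"
  proof (intro finite_measure_mono subsetI)
    fix \<omega> assume "\<omega> \<in> (\<lambda>\<omega>. (X \<omega>, Y \<omega>)) -` (ball y (r/2) \<times> ball z (r/2)) \<inter> space M"
    hence "\<omega> \<in> space M" "dist y (X \<omega>) < r/2" "dist z (Y \<omega>) < r/2"
      by auto
    moreover have "dist (y + z) (X \<omega> + Y \<omega>) \<le> dist y (X \<omega>) + dist z (Y \<omega>)"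
      by (rule dist_triangle_add)
    ultimately show "\<omega> \<in> {\<omega> \<in> space M. X \<omega> + Y \<omega> \<in> ball (y + z) r}"
      by simp
  next
    have "(\<lambda>\<omega>. X \<omega> + Y \<omega>) \<in> borel_measurable M"
      by measurable
    from measurable_sets[OF this, of "ball (y + z) r"]
    show "{\<omega> \<in> space M. X \<omega> + Y \<omega> \<in> ball (y + z) r} \<in> events"
      by (simp add: vimage_def Int_def conj_commute)
  qed
  finally show "prob {\<omega> \<in> space M. X \<omega> + Y \<omega> \<in> ball (y + z) r} > 0" .
qed

lemma support_point_distr_cong:
  assumes [measurable]: "X \<in> borel_measurable M" "Y \<in> borel_measurable M"
    and eq: "distr M borel X = distr M borel Y" and "support_point M X y"
  shows "support_point M Y y"
proof -
  have *: "prob {\<omega> \<in> space M. Z \<omega> \<in> ball y r} = measure (distr M borel Z) (ball y r)"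
    if [measurable]: "Z \<in> borel_measurable M" for Z r
    by (subst measure_distr) (auto intro!: arg_cong[where f = prob])
  show ?thesis
    using assms(4) unfolding support_point_def *[OF assms(1)] *[OF assms(2)] eq .
qed

lemma support_point_AE_cong:
  fixes X Y :: "'a \<Rightarrow> 'h::{metric_space, second_countable_topology}"
  assumes [measurable]: "X \<in> borel_measurable M" "Y \<in> borel_measurable M"
    and "AE \<omega> in M. X \<omega> = Y \<omega>" "support_point M X y"
  shows "support_point M Y y"
  by (rule support_point_distr_cong[OF assms(1,2) distr_cong_AE[OF refl refl assms(3,1,2)] assms(4)])

end

section \<open>Stable laws have full support\<close>

lemma char_distr_mult:
  assumes [measurable]: "X \<in> borel_measurable M"
  shows "char (distr M borel (\<lambda>\<omega>. k * X \<omega>)) h = char (distr M borel X) (h * k)"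
  by (simp add: char_def integral_distr mult.assoc)

lemma stable_levy_process_char:
  "stable_levy_process M \<alpha> Y \<Longrightarrow> t \<ge> 0 \<Longrightarrow>
    char (distr M borel (Y t)) h = complex_of_real (exp (- t * \<bar>h\<bar> powr \<alpha>))"
  unfolding stable_levy_process_def by blast

lemma stable_levy_process_measurable:
  "stable_levy_process M \<alpha> Y \<Longrightarrow> t \<ge> 0 \<Longrightarrow> Y t \<in> borel_measurable M"
  by (auto simp: stable_levy_process_def levy_process_def)

context prob_space
begin

lemma distr_eqI_char:
  fixes X Y :: "'a \<Rightarrow> real"
  assumes [measurable]: "X \<in> borel_measurable M" "Y \<in> borel_measurable M"
    and "\<And>h. char (distr M borel X) h = char (distr M borel Y) h"
  shows "distr M borel X = distr M borel Y"
  using assms by (intro Levy_uniqueness real_distribution_distr ext) auto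

lemma indep_vars_imp_indep_var:
  assumes ind: "indep_vars M' X I" and ij: "i \<in> I" "j \<in> I" "i \<noteq> j"
  shows "indep_var (M' i) (X i) (M' j) (X j)"
proof -
  have "indep_var (M' i) ((\<lambda>p. p i) \<circ> (\<lambda>\<omega>. restrict (\<lambda>i. X i \<omega>) {i}))
          (M' j) ((\<lambda>p. p j) \<circ> (\<lambda>\<omega>. restrict (\<lambda>i. X i \<omega>) {j}))"
    using ij by (intro indep_var_compose[OF indep_var_restrict[OF ind]] measurable_component_singleton) auto
  then show ?thesis
    by (simp add: comp_def)
qed

lemma levy_process_stationary:
  "levy_process M Y \<Longrightarrow> 0 \<le> s \<Longrightarrow> s \<le> t \<Longrightarrow>
    distr M borel (\<lambda>\<omega>. Y t \<omega> - Y s \<omega>) = distr M borel (Y (t - s))"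
  unfolding levy_process_def by blast

lemma levy_process_indep_increments:
  "levy_process M Y \<Longrightarrow> 0 \<le> \<tau> (0::nat) \<Longrightarrow> (\<And>i. i < N \<Longrightarrow> \<tau> i \<le> \<tau> (Suc i)) \<Longrightarrow>
    indep_vars (\<lambda>_. borel) (\<lambda>i \<omega>. Y (\<tau> (Suc i)) \<omega> - Y (\<tau> i) \<omega>) {..<N}"
  unfolding levy_process_def by blast

text \<open>Self-similarity: k Y_c has the law of Y at time |k|^\<alpha> c, as a comparison of
  characteristic functions shows. Negative k are included, which gives the symmetry of the
  support.\<close>

lemma stable_support_mult:
  assumes Y: "stable_levy_process M \<alpha> Y" and c: "c \<ge> 0" and k: "k \<noteq> 0" and "support_point M (Y c) y"
  shows "support_point M (Y (\<bar>k\<bar> powr \<alpha> * c)) (k * y)"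
proof -
  have m: "Y c \<in> borel_measurable M" "Y (\<bar>k\<bar> powr \<alpha> * c) \<in> borel_measurable M"
    using c by (auto intro!: stable_levy_process_measurable[OF Y])
  have "support_point M (\<lambda>\<omega>. k * Y c \<omega>) (k * y)"
    unfolding support_point_def
  proof safe
    fix r :: real assume r: "r > 0"
    have "prob {\<omega> \<in> space M. Y c \<omega> \<in> ball y (r / \<bar>k\<bar>)} > 0"
      using assms(4) r k by (simp add: support_point_def del: mem_ball)
    moreover have "Y c \<omega> \<in> ball y (r / \<bar>k\<bar>) \<longleftrightarrow> k * Y c \<omega> \<in> ball (k * y) r" for \<omega>
      using k by (simp add: dist_real_def right_diff_distrib[symmetric] abs_mult pos_less_divide_eq
          mult.commute)
    ultimately show "prob {\<omega> \<in> space M. k * Y c \<omega> \<in> ball (k * y) r} > 0"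
      by simp
  qed
  moreover have "distr M borel (\<lambda>\<omega>. k * Y c \<omega>) = distr M borel (Y (\<bar>k\<bar> powr \<alpha> * c))"
    using m c by (intro distr_eqI_char borel_measurable_times borel_measurable_const)
      (simp_all add: char_distr_mult stable_levy_process_char[OF Y] abs_mult powr_mult mult_ac)
  ultimately show ?thesis
    by (intro support_point_distr_cong[OF borel_measurable_times[OF borel_measurable_const m(1)] m(2)])
qed

text \<open>Y at time a + b is almost surely the sum of its increments over [0, a] and [a, a + b],
  which are independent and distributed as Y at times a and b.\<close>

lemma stable_support_add:
  assumes Y: "stable_levy_process M \<alpha> Y" and ab: "a \<ge> 0" "b \<ge> 0"
    and "support_point M (Y a) y" "support_point M (Y b) z"
  shows "support_point M (Y (a + b)) (y + z)"
proof -
  define \<tau> :: "nat \<Rightarrow> real" where "\<tau> i = (if i = 0 then 0 else if i = 1 then a else a + b)" for i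
  have levy: "levy_process M Y"
    using Y by (simp add: stable_levy_process_def)
  have m: "Y 0 \<in> borel_measurable M" "Y a \<in> borel_measurable M"
    "Y b \<in> borel_measurable M" "Y (a + b) \<in> borel_measurable M"
    using ab by (auto intro!: stable_levy_process_measurable[OF Y])
  have Y0: "AE \<omega> in M. Y 0 \<omega> = 0"
    using levy by (simp add: levy_process_def)
  have stat: "distr M borel (\<lambda>\<omega>. Y (a + b) \<omega> - Y a \<omega>) = distr M borel (Y b)"
    using levy_process_stationary[OF levy, of a "a + b"] ab by simp
  have "0 \<le> \<tau> 0 \<and> (\<forall>i<2. \<tau> i \<le> \<tau> (Suc i))"
    using ab by (auto simp: \<tau>_def)
  hence "indep_vars (\<lambda>_. borel) (\<lambda>i \<omega>. Y (\<tau> (Suc i)) \<omega> - Y (\<tau> i) \<omega>) {..<2}"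
    by (intro levy_process_indep_increments levy) auto
  from indep_vars_imp_indep_var[OF this, of 0 1]
  have ind: "indep_var borel (\<lambda>\<omega>. Y a \<omega> - Y 0 \<omega>) borel (\<lambda>\<omega>. Y (a + b) \<omega> - Y a \<omega>)"
    by (simp add: \<tau>_def)
  have "support_point M (\<lambda>\<omega>. Y a \<omega> - Y 0 \<omega>) y"
    using Y0 by (intro support_point_AE_cong[OF _ _ _ assms(4)] borel_measurable_diff m) auto
  moreover have "support_point M (\<lambda>\<omega>. Y (a + b) \<omega> - Y a \<omega>) z"
    by (intro support_point_distr_cong[OF _ _ stat[symmetric] assms(5)] borel_measurable_diff m)
  ultimately have sum: "support_point M (\<lambda>\<omega>. (Y a \<omega> - Y 0 \<omega>) + (Y (a + b) \<omega> - Y a \<omega>)) (y + z)"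
    by (intro support_point_add ind)
  have "AE \<omega> in M. (Y a \<omega> - Y 0 \<omega>) + (Y (a + b) \<omega> - Y a \<omega>) = Y (a + b) \<omega>"
    using Y0 by eventually_elim simp
  from support_point_AE_cong[OF _ _ this sum] show ?thesis
    by (simp del: add_diff_cancel add: m borel_measurable_diff borel_measurable_add)
qed

text \<open>Some y lies in the support at time c / 2, and by symmetry so does - y; the two halves of
  the time interval add up to 0.\<close>

lemma stable_support_0:
  assumes Y: "stable_levy_process M \<alpha> Y" and c: "c \<ge> 0"
  shows "support_point M (Y c) 0"
proof -
  have [measurable]: "Y (c / 2) \<in> borel_measurable M"
    using c by (auto intro!: stable_levy_process_measurable[OF Y])
  obtain y where y: "support_point M (Y (c / 2)) y"
    using ex_support_point[of "Y (c / 2)" UNIV] by (auto simp: prob_space)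
  have "support_point M (Y (c / 2)) (- y)"
    using stable_support_mult[OF Y _ _ y, of "-1"] c by simp
  from stable_support_add[OF Y _ _ y this] show ?thesis
    using c by simp
qed

text \<open>A bounded random variable has a characteristic function with \<open>1 - Re \<phi>(h) = O(h\<^sup>2)\<close>,
  whereas \<open>1 - exp (- c \<bar>h\<bar>\<^sup>\<alpha>)\<close> is of order \<open>\<bar>h\<bar>\<^sup>\<alpha>\<close> with \<open>\<alpha> < 2\<close>.\<close>

lemma stable_unbounded:
  assumes Y: "stable_levy_process M \<alpha> Y" and \<alpha>: "0 < \<alpha>" "\<alpha> < 2" and c: "c > 0"
  shows "\<not> (AE \<omega> in M. \<bar>Y c \<omega>\<bar> \<le> R)"
proof
  assume bdd: "AE \<omega> in M. \<bar>Y c \<omega>\<bar> \<le> R"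
  have [measurable]: "Y c \<in> borel_measurable M"
    using c by (auto intro!: stable_levy_process_measurable[OF Y])
  have "AE \<omega> in M. 0 \<le> R"
    using bdd by eventually_elim auto
  hence R: "R \<ge> 0"
    by simp
  have bound: "1 - h\<^sup>2 * R\<^sup>2 / 2 \<le> exp (- c * \<bar>h\<bar> powr \<alpha>)" for h
  proof -
    have int: "integrable M (\<lambda>\<omega>. iexp (h * Y c \<omega>))"
      by (rule integrable_const_bound[of _ 1]) auto
    have "exp (- c * \<bar>h\<bar> powr \<alpha>) = Re (char (distr M borel (Y c)) h)"
      using c by (subst stable_levy_process_char[OF Y]) auto
    also have "char (distr M borel (Y c)) h = (CLINT \<omega>|M. iexp (h * Y c \<omega>))"
      by (simp add: char_def integral_distr)
    also have "Re \<dots> = (LINT \<omega>|M. cos (h * Y c \<omega>))"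
      using int by (subst integral_Re[symmetric]) (auto simp: Re_exp)
    also have "\<dots> \<ge> (LINT \<omega>|M. 1 - h\<^sup>2 * R\<^sup>2 / 2)"
    proof (rule integral_mono_AE)
      show "integrable M (\<lambda>\<omega>. cos (h * Y c \<omega>))"
        by (rule integrable_const_bound[of _ 1]) auto
      show "AE \<omega> in M. 1 - h\<^sup>2 * R\<^sup>2 / 2 \<le> cos (h * Y c \<omega>)"
        using bdd
      proof eventually_elim
        case (elim \<omega>)
        \<comment> \<open>For x = h Y_c, the identity cos x = 1 - 2 sin(x/2)^2 together with
          |sin(x/2)| \<le> |x/2| gives the quadratic bound.\<close>
        have "1 - (h * Y c \<omega>)\<^sup>2 / 2 \<le> cos (h * Y c \<omega>)"
          using abs_sin_x_le_abs_x[of "h * Y c \<omega> / 2"] cos_double_sin[of "h * Y c \<omega> / 2"]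
          unfolding abs_le_square_iff power_divide by simp
        moreover have "(h * Y c \<omega>)\<^sup>2 \<le> h\<^sup>2 * R\<^sup>2"
          using elim R by (simp add: power_mult_distrib mult_left_mono abs_le_square_iff[symmetric])
        ultimately show ?case by simp
      qed
    qed simp
    finally show ?thesis by (simp add: prob_space)
  qed
  have "((\<lambda>h. h powr (2 - \<alpha>) * R\<^sup>2) \<longlongrightarrow> 0 * R\<^sup>2) (at_right 0)"
    using \<alpha> by (intro tendsto_mult tendsto_const tendsto_zero_powrI[OF tendsto_ident_at tendsto_const])
      (auto simp: eventually_at_right_less eventually_at_filter)
  hence "eventually (\<lambda>h. h powr (2 - \<alpha>) * R\<^sup>2 < c) (at_right 0)"
    using c by (intro order_tendstoD(2)[of _ 0]) auto
  moreover have "((\<lambda>h. c * h powr \<alpha>) \<longlongrightarrow> c * 0) (at_right 0)"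
    using \<alpha> by (intro tendsto_mult tendsto_const tendsto_zero_powrI[OF tendsto_ident_at tendsto_const])
      (auto simp: eventually_at_right_less eventually_at_filter)
  hence "eventually (\<lambda>h. c * h powr \<alpha> < 1) (at_right 0)"
    by (intro order_tendstoD(2)[of _ 0]) auto
  \<comment> \<open>For such h and u = c h^\<alpha>, \<open>bound\<close> and exp (- u) \<le> 1 - u
    / 2 give u \<le> h^2 R^2 = h^\<alpha> (h^(2 - \<alpha>) R^2) < h^\<alpha> c = u, a
    contradiction. The condition u < 1 is what the estimate of exp (- u) uses.\<close>
  ultimately have "eventually (\<lambda>h. h powr (2 - \<alpha>) * R\<^sup>2 < c \<and> c * h powr \<alpha> < 1 \<and> h > 0) (at_right 0)"
    using eventually_at_right_less[of 0] by eventually_elim auto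
  then obtain h where h: "h powr (2 - \<alpha>) * R\<^sup>2 < c" "c * h powr \<alpha> < 1" "h > 0"
    using eventually_happens'[OF trivial_limit_at_right_real] by blast
  define u where "u = c * h powr \<alpha>"
  have u: "0 < u" "u < 1"
    using h c by (auto simp: u_def)
  have "exp (- u) \<le> 1 - u / 2"
  proof -
    have "exp (- u) = 1 / exp u" by (simp add: exp_minus field_simps)
    also have "\<dots> \<le> 1 / (1 + u)"
      using u exp_ge_add_one_self[of u] by (intro divide_left_mono) auto
    also have "\<dots> \<le> 1 - u / 2"
      using u by (simp add: field_simps)
    finally show ?thesis .
  qed
  with bound[of h] h have "u \<le> h\<^sup>2 * R\<^sup>2"
    by (simp add: u_def)
  also have "h\<^sup>2 = h powr \<alpha> * h powr (2 - \<alpha>)"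
    using h by (simp flip: powr_add)
  also have "\<dots> * R\<^sup>2 = h powr \<alpha> * (h powr (2 - \<alpha>) * R\<^sup>2)"
    by simp
  also have "\<dots> < h powr \<alpha> * c"
    using h by (intro mult_strict_left_mono) auto
  finally show False
    by (simp add: u_def)
qed

text \<open>Unboundedness supplies a support point z with |z| > |y|, of either sign. Scaling by k =
  y / z reaches y at the earlier time |k|^\<alpha> c, and the remaining time (1 - |k|^\<alpha>) c
  adds the support point 0.\<close>

lemma stable_full_support:
  assumes Y: "stable_levy_process M \<alpha> Y" and \<alpha>: "0 < \<alpha>" "\<alpha> < 2" and c: "c > 0"
  shows "support_point M (Y c) y"
proof (cases "y = 0")
  case True
  then show ?thesis
    using stable_support_0[OF Y] c by simp
next
  case False
  have [measurable]: "Y c \<in> borel_measurable M"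
    using c by (auto intro!: stable_levy_process_measurable[OF Y])
  let ?U = "- cball (0::real) \<bar>y\<bar>"
  have "prob {\<omega> \<in> space M. Y c \<omega> \<in> ?U} \<noteq> 0"
    using stable_unbounded[OF Y \<alpha> c, of "\<bar>y\<bar>"] by (simp add: prob_eq_0 not_less)
  then obtain z where z: "\<bar>z\<bar> > \<bar>y\<bar>" "support_point M (Y c) z"
    using ex_support_point[of "Y c" ?U] by (auto simp: open_Compl zero_less_measure_iff not_le)
  define k where "k = y / z"
  have k: "k \<noteq> 0" "\<bar>k\<bar> < 1" "k * z = y"
    using z False by (auto simp: k_def)
  have "\<bar>k\<bar> powr \<alpha> \<le> 1"
    using k \<alpha> by (intro powr_le1) auto
  then have pos: "(1 - \<bar>k\<bar> powr \<alpha>) * c \<ge> 0"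
    using c by simp
  have "support_point M (Y (\<bar>k\<bar> powr \<alpha> * c)) y"
    using stable_support_mult[OF Y _ k(1) z(2)] c k(3) by simp
  from stable_support_add[OF Y _ pos this stable_support_0[OF Y pos]] show ?thesis
    using c by (simp add: algebra_simps)
qed

end

section \<open>Stochastic integrals over a final time interval\<close>

text \<open>Left-endpoint sums over \<open>Suc N\<close> equal pieces of [s, s + h], so every N
  gives a genuine partition. The path \<open>p\<close> is an argument because the same sums are
  later evaluated on a path, on its restriction to nonnegative times and on its increments after
  s.\<close>

definition riemann_sum :: "(real \<Rightarrow> real) \<Rightarrow> real \<Rightarrow> real \<Rightarrow> nat \<Rightarrow> (real \<Rightarrow> real) \<Rightarrow> real" where
  "riemann_sum f s h N p =
    (\<Sum>i<Suc N. f (s + real i * h / real (Suc N)) *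
       (p (s + real (Suc i) * h / real (Suc N)) - p (s + real i * h / real (Suc N))))"

lemma has_stoch_integralD:
  assumes "has_stoch_integral M f Y t J" "\<epsilon> > 0" "\<eta> > 0"
  shows "\<exists>\<delta>>0. \<forall>(N::nat) \<tau>.
    \<tau> 0 = 0 \<and> \<tau> N = t \<and> (\<forall>i<N. \<tau> i \<le> \<tau> (Suc i) \<and> \<tau> (Suc i) - \<tau> i < \<delta>) \<longrightarrow>
    measure M {\<omega> \<in> space M.
      \<bar>(\<Sum>i<N. f (\<tau> i) * (Y (\<tau> (Suc i)) \<omega> - Y (\<tau> i) \<omega>)) - J \<omega>\<bar> > \<epsilon>} < \<eta>"
  using assms unfolding has_stoch_integral_def by simp

lemma sum_lessThan_add:
  fixes a :: "nat \<Rightarrow> 'b::comm_monoid_add"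
  shows "(\<Sum>i<m + k. a i) = (\<Sum>i<m. a i) + (\<Sum>i<k. a (m + i))"
  by (induction k) (simp_all add: add_ac)

context prob_space
begin

text \<open>Choosing \<open>r k\<close> with error probability below 2^-k at tolerance 2^-k makes
  Borel-Cantelli applicable. The tolerances alone force convergence, so the indices
  \<open>r k\<close> may come in any order.\<close>

lemma AE_convergent_subsequence:
  fixes X :: "nat \<Rightarrow> 'a \<Rightarrow> real"
  assumes [measurable]: "\<And>n. X n \<in> borel_measurable M" "J \<in> borel_measurable M"
    and conv: "\<And>\<epsilon> \<eta>. \<epsilon> > 0 \<Longrightarrow> \<eta> > 0 \<Longrightarrow>
      eventually (\<lambda>n. prob {\<omega> \<in> space M. \<bar>X n \<omega> - J \<omega>\<bar> > \<epsilon>} < \<eta>) sequentially"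
  shows "\<exists>r::nat \<Rightarrow> nat. AE \<omega> in M. (\<lambda>k. X (r k) \<omega>) \<longlonglongrightarrow> J \<omega>"
proof -
  have "\<exists>n. prob {\<omega> \<in> space M. \<bar>X n \<omega> - J \<omega>\<bar> > (1/2)^k} < (1/2)^k" for k :: nat
    using eventually_happens'[OF _ conv[of "(1/2)^k" "(1/2)^k"]] by auto
  then obtain r where r: "\<And>k::nat. prob {\<omega> \<in> space M. \<bar>X (r k) \<omega> - J \<omega>\<bar> > (1/2)^k} < (1/2)^k"
    by metis
  have "AE \<omega> in M. eventually (\<lambda>k. \<omega> \<in> space M - {\<omega> \<in> space M. \<bar>X (r k) \<omega> - J \<omega>\<bar> > (1/2)^k}) sequentially"
  proof (rule borel_cantelli_AE1)
    show "summable (\<lambda>k. prob {\<omega> \<in> space M. \<bar>X (r k) \<omega> - J \<omega>\<bar> > (1/2)^k})"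
      by (rule summable_comparison_test'[of "\<lambda>k. (1/2)^k" 0])
        (use r in \<open>auto intro: less_imp_le summable_geometric\<close>)
  qed (auto simp: emeasure_eq_measure)
  then have "AE \<omega> in M. (\<lambda>k. X (r k) \<omega>) \<longlonglongrightarrow> J \<omega>"
  proof eventually_elim
    case (elim \<omega>)
    have "(\<lambda>k. X (r k) \<omega> - J \<omega>) \<longlonglongrightarrow> 0"
    proof (rule Lim_null_comparison)
      show "eventually (\<lambda>k. norm (X (r k) \<omega> - J \<omega>) \<le> (1/2)^k) sequentially"
        using elim by eventually_elim auto
      show "(\<lambda>k. (1/2)^k :: real) \<longlonglongrightarrow> 0"
        by (rule LIMSEQ_realpow_zero) auto
    qed
    then show ?case
      by (simp add: LIM_zero_iff)
  qed
  then show ?thesis by blast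
qed

text \<open>Additivity of the integral over adjacent intervals: a partition of [0, s] followed by
  one of [s, s + h] is a fine partition of [0, s + h]. Its first half sums to c times a Riemann sum
  of g, which is close to c K, and its second half is the sum in question.\<close>

lemma riemann_sum_tendsto_in_prob:
  assumes J: "has_stoch_integral M f Y (s + h) J" and K: "has_stoch_integral M g Y s K"
    and fg: "\<And>u. f u = c * g u" and s: "s \<ge> 0" and h: "h > 0"
    and meas: "\<And>t. t \<ge> 0 \<Longrightarrow> Y t \<in> borel_measurable M"
    and eps: "\<epsilon> > 0" "\<eta> > 0"
  shows "eventually (\<lambda>N. prob {\<omega> \<in> space M.
    \<bar>riemann_sum f s h N (\<lambda>u. Y u \<omega>) - (J \<omega> - c * K \<omega>)\<bar> > \<epsilon>} < \<eta>) sequentially"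
proof -
  have [measurable]: "J \<in> borel_measurable M" "K \<in> borel_measurable M"
    using J K by (auto simp: has_stoch_integral_def)
  \<comment> \<open>The error in K is multiplied by |c|; adding 1 in the denominator keeps the
    quotient meaningful for c = 0.\<close>
  define \<epsilon>' where "\<epsilon>' = \<epsilon> / (2 * (\<bar>c\<bar> + 1))"
  have \<epsilon>': "\<epsilon>' > 0" "\<bar>c\<bar> * \<epsilon>' \<le> \<epsilon> / 2"
    using eps by (auto simp: \<epsilon>'_def field_simps)
  let ?S = "\<lambda>f \<tau> N \<omega>. \<Sum>i<N. f (\<tau> i) * (Y (\<tau> (Suc i)) \<omega> - Y (\<tau> i) \<omega>)"
  obtain \<delta>1 where \<delta>1: "\<delta>1 > 0" "\<forall>(N::nat) \<tau>. \<tau> 0 = 0 \<and> \<tau> N = s + h \<and>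
      (\<forall>i<N. \<tau> i \<le> \<tau> (Suc i) \<and> \<tau> (Suc i) - \<tau> i < \<delta>1) \<longrightarrow>
      prob {\<omega> \<in> space M. \<bar>?S f \<tau> N \<omega> - J \<omega>\<bar> > \<epsilon> / 2} < \<eta> / 2"
    using has_stoch_integralD[OF J half_gt_zero[OF eps(1)] half_gt_zero[OF eps(2)]]
    by (elim exE conjE)
  obtain \<delta>2 where \<delta>2: "\<delta>2 > 0" "\<forall>(N::nat) \<tau>. \<tau> 0 = 0 \<and> \<tau> N = s \<and>
      (\<forall>i<N. \<tau> i \<le> \<tau> (Suc i) \<and> \<tau> (Suc i) - \<tau> i < \<delta>2) \<longrightarrow>
      prob {\<omega> \<in> space M. \<bar>?S g \<tau> N \<omega> - K \<omega>\<bar> > \<epsilon>'} < \<eta> / 2"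
    using has_stoch_integralD[OF K \<epsilon>'(1) half_gt_zero[OF eps(2)]]
    by (elim exE conjE)
  have ev: "eventually (\<lambda>N. a / real (Suc N) < \<delta>) sequentially" if "\<delta> > 0" for a \<delta> :: real
    using that by (intro order_tendstoD(2)[OF LIMSEQ_Suc[OF lim_const_over_n[of a]]])
  show ?thesis
    using ev[OF \<delta>1(1), of s] ev[OF \<delta>1(1), of h] ev[OF \<delta>2(1), of s]
  proof eventually_elim
    case (elim N)
    define m where "m = Suc N"
    define \<tau> where "\<tau> i = real i * s / real m" for i
    \<comment> \<open>The concatenated partition with m steps on each side; at index m both branches
      have the value s.\<close>
    define \<sigma> where "\<sigma> i = (if i \<le> m then \<tau> i else s + real (i - m) * h / real m)" for i
    have m: "m > 0" by (simp add: m_def)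
    have \<tau>: "\<tau> 0 = 0" "\<tau> m = s" "\<tau> (Suc i) - \<tau> i = s / real m" for i
      using m by (auto simp: \<tau>_def field_simps)
    have \<sigma>_add: "\<sigma> (m + i) = s + real i * h / real m" for i
      using m by (cases "i = 0") (auto simp: \<sigma>_def \<tau>_def)
    have \<sigma>_low: "i < m \<Longrightarrow> \<sigma> i = \<tau> i \<and> \<sigma> (Suc i) = \<tau> (Suc i)" for i
      by (auto simp: \<sigma>_def)
    have \<sigma>_diff: "\<sigma> (Suc i) - \<sigma> i = (if i < m then s / real m else h / real m)" for i
    proof (cases "i < m")
      case True
      then show ?thesis using \<sigma>_low[of i] \<tau>(3)[of i] by simp
    next
      case False
      then obtain j where j: "i = m + j" by (metis le_Suc_ex not_less)
      then show ?thesis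
        using m \<sigma>_add[of j] \<sigma>_add[of "Suc j"] by (simp add: field_simps)
    qed
    have p1: "prob {\<omega> \<in> space M. \<bar>?S f \<sigma> (m + m) \<omega> - J \<omega>\<bar> > \<epsilon> / 2} < \<eta> / 2"
    proof (rule \<delta>1(2)[THEN spec, THEN spec, THEN mp], intro conjI)
      show "\<sigma> 0 = 0" "\<sigma> (m + m) = s + h"
        using m \<sigma>_add[of m] by (auto simp: \<sigma>_def \<tau>_def)
      have "\<sigma> i \<le> \<sigma> (Suc i) \<and> \<sigma> (Suc i) - \<sigma> i < \<delta>1" for i
      proof -
        have "0 \<le> \<sigma> (Suc i) - \<sigma> i \<and> \<sigma> (Suc i) - \<sigma> i < \<delta>1"
          unfolding \<sigma>_diff using elim s h by (simp add: m_def)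
        then show ?thesis by simp
      qed
      then show "\<forall>i<m + m. \<sigma> i \<le> \<sigma> (Suc i) \<and> \<sigma> (Suc i) - \<sigma> i < \<delta>1" by blast
    qed
    have p2: "prob {\<omega> \<in> space M. \<bar>?S g \<tau> m \<omega> - K \<omega>\<bar> > \<epsilon>'} < \<eta> / 2"
    proof (rule \<delta>2(2)[THEN spec, THEN spec, THEN mp], intro conjI)
      have "\<tau> i \<le> \<tau> (Suc i) \<and> \<tau> (Suc i) - \<tau> i < \<delta>2" for i
      proof -
        have "0 \<le> \<tau> (Suc i) - \<tau> i \<and> \<tau> (Suc i) - \<tau> i < \<delta>2"
          unfolding \<tau>(3) using elim s by (simp add: m_def)
        then show ?thesis by simp
      qed
      then show "\<forall>i<m. \<tau> i \<le> \<tau> (Suc i) \<and> \<tau> (Suc i) - \<tau> i < \<delta>2" by blast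
    qed (use \<tau> in auto)
    have split: "?S f \<sigma> (m + m) \<omega> = c * ?S g \<tau> m \<omega> + riemann_sum f s h N (\<lambda>u. Y u \<omega>)" for \<omega>
    proof -
      have "(\<Sum>i<m. f (\<sigma> i) * (Y (\<sigma> (Suc i)) \<omega> - Y (\<sigma> i) \<omega>)) = c * ?S g \<tau> m \<omega>"
        unfolding sum_distrib_left using \<sigma>_low by (intro sum.cong) (auto simp: fg)
      moreover have "(\<Sum>i<m. f (\<sigma> (m + i)) * (Y (\<sigma> (Suc (m + i))) \<omega> - Y (\<sigma> (m + i)) \<omega>)) =
          riemann_sum f s h N (\<lambda>u. Y u \<omega>)"
        unfolding add_Suc_right[symmetric] \<sigma>_add riemann_sum_def m_def[symmetric] ..
      ultimately show ?thesis
        unfolding sum_lessThan_add by simp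
    qed
    let ?E1 = "{\<omega> \<in> space M. \<bar>?S f \<sigma> (m + m) \<omega> - J \<omega>\<bar> > \<epsilon> / 2}"
    let ?E2 = "{\<omega> \<in> space M. \<bar>?S g \<tau> m \<omega> - K \<omega>\<bar> > \<epsilon>'}"
    have \<tau>_nn: "\<tau> i \<ge> 0" for i
      using s by (simp add: \<tau>_def)
    have \<sigma>_nn: "\<sigma> i \<ge> 0" for i
      using s h \<tau>_nn by (simp add: \<sigma>_def)
    note [measurable] = meas[OF \<tau>_nn] meas[OF \<sigma>_nn]
    have E: "?E1 \<in> events" "?E2 \<in> events" by measurable
    have "prob {\<omega> \<in> space M. \<bar>riemann_sum f s h N (\<lambda>u. Y u \<omega>) - (J \<omega> - c * K \<omega>)\<bar> > \<epsilon>}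
        \<le> prob (?E1 \<union> ?E2)"
    proof (intro finite_measure_mono subsetI)
      fix \<omega> assume *: "\<omega> \<in> {\<omega> \<in> space M. \<bar>riemann_sum f s h N (\<lambda>u. Y u \<omega>) - (J \<omega> - c * K \<omega>)\<bar> > \<epsilon>}"
      show "\<omega> \<in> ?E1 \<union> ?E2"
      proof (rule ccontr)
        assume "\<omega> \<notin> ?E1 \<union> ?E2"
        with * have le: "\<bar>?S f \<sigma> (m + m) \<omega> - J \<omega>\<bar> \<le> \<epsilon> / 2" "\<bar>?S g \<tau> m \<omega> - K \<omega>\<bar> \<le> \<epsilon>'"
          by (auto simp: not_less)
        have "riemann_sum f s h N (\<lambda>u. Y u \<omega>) - (J \<omega> - c * K \<omega>) =
            (?S f \<sigma> (m + m) \<omega> - J \<omega>) - c * (?S g \<tau> m \<omega> - K \<omega>)"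
          unfolding split by (simp add: algebra_simps)
        also have "\<bar>\<dots>\<bar> \<le> \<bar>?S f \<sigma> (m + m) \<omega> - J \<omega>\<bar> + \<bar>c\<bar> * \<bar>?S g \<tau> m \<omega> - K \<omega>\<bar>"
          unfolding abs_mult[symmetric] by (rule abs_triangle_ineq4)
        also have "\<dots> \<le> \<epsilon> / 2 + \<bar>c\<bar> * \<epsilon>'"
          using le by (intro add_mono mult_left_mono) auto
        finally show False
          using * \<epsilon>'(2) by simp
      qed
    qed (use E in blast)
    also have "\<dots> \<le> prob ?E1 + prob ?E2"
      by (rule measure_Un_le) (use E in auto)
    finally show ?case
      using p1 p2 by linarith
  qed
qed

text \<open>A weighted sum of independent stable increments is again stable, the weights entering
  through their \<alpha>-th powers. The resulting scale is itself a Riemann sum of |f|^\<alpha> over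
  [s, s + h].\<close>

lemma stable_riemann_sum_char:
  assumes Y: "stable_levy_process M \<alpha> Y" and s: "s \<ge> 0" and h: "h > 0"
  shows "char (distr M borel (\<lambda>\<omega>. riemann_sum f s h N (\<lambda>u. Y u \<omega>))) \<theta> =
    complex_of_real (exp (- (h / real (Suc N) *
      (\<Sum>i<Suc N. \<bar>f (s + real i * h / real (Suc N))\<bar> powr \<alpha>)) * \<bar>\<theta>\<bar> powr \<alpha>))"
proof -
  define \<tau> where "\<tau> i = s + real i * h / real (Suc N)" for i
  have \<tau>_nn: "\<tau> i \<ge> 0" for i
    using s h by (simp add: \<tau>_def)
  have \<tau>_diff: "\<tau> (Suc i) - \<tau> i = h / real (Suc N)" for i
    by (simp add: \<tau>_def distrib_right add_divide_distrib)
  have \<tau>_mono: "\<tau> i \<le> \<tau> (Suc i)" for i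
    using \<tau>_diff[of i] h by (metis diff_ge_0_iff_ge divide_nonneg_nonneg less_imp_le of_nat_0_le_iff)
  have levy: "levy_process M Y"
    using Y by (simp add: stable_levy_process_def)
  note [measurable] = stable_levy_process_measurable[OF Y \<tau>_nn]
  have ind: "indep_vars (\<lambda>_. borel) (\<lambda>i \<omega>. Y (\<tau> (Suc i)) \<omega> - Y (\<tau> i) \<omega>) {..<Suc N}"
    by (intro levy_process_indep_increments levy \<tau>_nn \<tau>_mono)
  have ind': "indep_vars (\<lambda>_. borel) (\<lambda>i \<omega>. f (\<tau> i) * (Y (\<tau> (Suc i)) \<omega> - Y (\<tau> i) \<omega>)) {..<Suc N}"
    by (rule indep_vars_compose2[OF ind, where Y = "\<lambda>i x. f (\<tau> i) * x"]) auto
  have "char (distr M borel (\<lambda>\<omega>. f (\<tau> i) * (Y (\<tau> (Suc i)) \<omega> - Y (\<tau> i) \<omega>))) \<theta> =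
      complex_of_real (exp (- (h / real (Suc N)) * \<bar>\<theta> * f (\<tau> i)\<bar> powr \<alpha>))" for i
    using h by (simp add: char_distr_mult levy_process_stationary[OF levy \<tau>_nn \<tau>_mono] \<tau>_diff
        stable_levy_process_char[OF Y] del: of_nat_Suc)
  then have "char (distr M borel (\<lambda>\<omega>. \<Sum>i<Suc N. f (\<tau> i) * (Y (\<tau> (Suc i)) \<omega> - Y (\<tau> i) \<omega>))) \<theta> =
      (\<Prod>i<Suc N. complex_of_real (exp (- (h / real (Suc N)) * \<bar>\<theta> * f (\<tau> i)\<bar> powr \<alpha>)))"
    by (simp only: char_distr_sum[OF ind'])
  also have "\<dots> = complex_of_real (exp (\<Sum>i<Suc N. - (h / real (Suc N)) * \<bar>\<theta> * f (\<tau> i)\<bar> powr \<alpha>))"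
    by (simp only: exp_sum[OF finite_lessThan] of_real_prod)
  also have "(\<Sum>i<Suc N. - (h / real (Suc N)) * \<bar>\<theta> * f (\<tau> i)\<bar> powr \<alpha>) =
      - (h / real (Suc N) * (\<Sum>i<Suc N. \<bar>f (\<tau> i)\<bar> powr \<alpha>)) * \<bar>\<theta>\<bar> powr \<alpha>"
    unfolding sum_distrib_left sum_distrib_right sum_negf[symmetric]
    by (intro sum.cong) (simp_all add: abs_mult powr_mult mult_ac del: of_nat_Suc)
  finally show ?thesis
    by (simp only: riemann_sum_def \<tau>_def)
qed

text \<open>The scale \<open>c\<close> below is \<open>\<integral> f\<^sup>\<alpha>\<close> over \<open>[s, s + h]\<close>, but it suffices to obtain it from a
  subsequence by compactness, the bounds on \<open>f\<close> keeping it away from \<open>0\<close>.\<close>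

lemma stable_riemann_limit_distr:
  assumes Y: "stable_levy_process M \<alpha> Y" and \<alpha>: "\<alpha> > 0" and s: "s \<ge> 0" and h: "h > 0"
    and f: "\<And>u. s \<le> u \<Longrightarrow> u \<le> s + h \<Longrightarrow> m \<le> f u \<and> f u \<le> B" and m: "m > 0"
    and V: "V \<in> borel_measurable M"
    and lim: "AE \<omega> in M. (\<lambda>k. riemann_sum f s h (r k) (\<lambda>u. Y u \<omega>)) \<longlonglongrightarrow> V \<omega>"
  shows "\<exists>c>0. distr M borel V = distr M borel (Y c)"
proof -
  note [measurable] = V
  have nn: "s + real i * h / real (Suc N) \<ge> 0" for i N
    using s h by simp
  note [measurable] = stable_levy_process_measurable[OF Y nn]
  have R[measurable]: "(\<lambda>\<omega>. riemann_sum f s h N (\<lambda>u. Y u \<omega>)) \<in> borel_measurable M" for N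
    unfolding riemann_sum_def by measurable
  define C where "C N = h / real (Suc N) *
      (\<Sum>i<Suc N. \<bar>f (s + real i * h / real (Suc N))\<bar> powr \<alpha>)" for N
  have C: "C N \<in> {h * m powr \<alpha>..h * B powr \<alpha>}" for N
  proof -
    have *: "m powr \<alpha> \<le> \<bar>f (s + real i * h / real (Suc N))\<bar> powr \<alpha> \<and>
        \<bar>f (s + real i * h / real (Suc N))\<bar> powr \<alpha> \<le> B powr \<alpha>" if "i < Suc N" for i
    proof -
      have "real i * h / real (Suc N) \<le> h"
        using that h mult_right_mono[of "real i" "real (Suc N)" h]
        by (simp add: divide_le_eq mult.commute del: of_nat_Suc)
      then have "m \<le> f (s + real i * h / real (Suc N))" "f (s + real i * h / real (Suc N)) \<le> B"
        using f[of "s + real i * h / real (Suc N)"] h by auto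
      then show ?thesis
        using m \<alpha> by (auto intro!: powr_mono2)
    qed
    have "real (Suc N) * m powr \<alpha> \<le> (\<Sum>i<Suc N. \<bar>f (s + real i * h / real (Suc N))\<bar> powr \<alpha>)"
      using sum_bounded_below[of "{..<Suc N}" "m powr \<alpha>" "\<lambda>i. \<bar>f (s + real i * h / real (Suc N))\<bar> powr \<alpha>"] *
      by simp
    moreover have "(\<Sum>i<Suc N. \<bar>f (s + real i * h / real (Suc N))\<bar> powr \<alpha>) \<le> real (Suc N) * B powr \<alpha>"
      using sum_bounded_above[of "{..<Suc N}" "\<lambda>i. \<bar>f (s + real i * h / real (Suc N))\<bar> powr \<alpha>" "B powr \<alpha>"] *
      by simp
    ultimately have "h / real (Suc N) * (real (Suc N) * m powr \<alpha>) \<le> C N"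
        "C N \<le> h / real (Suc N) * (real (Suc N) * B powr \<alpha>)"
      unfolding C_def using h by (intro mult_left_mono; simp)+
    then show ?thesis by simp
  qed
  have "seq_compact {h * m powr \<alpha>..h * B powr \<alpha>}"
    by (simp add: compact_imp_seq_compact)
  \<comment> \<open>Compactness is applied to \<open>C (r k)\<close> and not to \<open>C\<close>,
    since \<open>r\<close> need not be increasing; passing to the increasing \<open>q\<close>
    preserves the limit along \<open>r\<close>.\<close>
  then obtain c q where c: "c \<in> {h * m powr \<alpha>..h * B powr \<alpha>}" and q: "strict_mono q"
      and lim_C: "((\<lambda>k. C (r k)) \<circ> q) \<longlonglongrightarrow> c"
    using C by (elim seq_compactE[of _ "\<lambda>k. C (r k)"]) auto
  have "0 < h * m powr \<alpha>" using h m by simp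
  with c have cpos: "c > 0" by auto
  have "distr M borel V = distr M borel (Y c)"
  proof (rule distr_eqI_char)
    show "Y c \<in> borel_measurable M"
      using cpos by (auto intro!: stable_levy_process_measurable[OF Y])
    fix \<theta>
    have "(\<lambda>k. CLINT \<omega>|M. iexp (\<theta> * riemann_sum f s h (r k) (\<lambda>u. Y u \<omega>)))
        \<longlonglongrightarrow> (CLINT \<omega>|M. iexp (\<theta> * V \<omega>))"
    proof (rule integral_dominated_convergence[where w = "\<lambda>_. 1"])
      show "AE \<omega> in M. (\<lambda>k. iexp (\<theta> * riemann_sum f s h (r k) (\<lambda>u. Y u \<omega>))) \<longlonglongrightarrow> iexp (\<theta> * V \<omega>)"
        using lim by eventually_elim (auto intro!: tendsto_intros)
    qed auto
    then have "(\<lambda>k. char (distr M borel (\<lambda>\<omega>. riemann_sum f s h (r k) (\<lambda>u. Y u \<omega>))) \<theta>)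
        \<longlonglongrightarrow> char (distr M borel V) \<theta>"
      by (simp add: char_def integral_distr)
    then have "(\<lambda>k. complex_of_real (exp (- C (r k) * \<bar>\<theta>\<bar> powr \<alpha>))) \<longlonglongrightarrow> char (distr M borel V) \<theta>"
      unfolding stable_riemann_sum_char[OF Y s h] C_def .
    from LIMSEQ_subseq_LIMSEQ[OF this q]
    have "(\<lambda>k. complex_of_real (exp (- C (r (q k)) * \<bar>\<theta>\<bar> powr \<alpha>))) \<longlonglongrightarrow> char (distr M borel V) \<theta>"
      by (simp add: comp_def)
    moreover have "(\<lambda>k. complex_of_real (exp (- C (r (q k)) * \<bar>\<theta>\<bar> powr \<alpha>)))
        \<longlonglongrightarrow> complex_of_real (exp (- c * \<bar>\<theta>\<bar> powr \<alpha>))"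
      using lim_C unfolding comp_def by (intro tendsto_intros)
    ultimately show "char (distr M borel V) \<theta> = char (distr M borel (Y c)) \<theta>"
      using cpos by (simp only: stable_levy_process_char[OF Y less_imp_le] LIMSEQ_unique)
  qed (rule V)
  with cpos show ?thesis by blast
qed

end

section \<open>Random series in a Hilbert space\<close>

lemma Collect_mem_eq_vimage: "{\<omega> \<in> S. X \<omega> \<in> B} = X -` B \<inter> S"
  by auto

context prob_space
begin

text \<open>The ball around \<open>y\<close> is hit when finitely many coefficients are close to those of \<open>y\<close> and the
  remaining tail is small. These events are independent, and the tail event has positive
  probability for some late index because the tails of a convergent series tend to \<open>0\<close>.\<close>

lemma support_point_orthonormal_series:
  fixes e :: "nat \<Rightarrow> 'h::{real_inner, banach, second_countable_topology}"
  assumes e: "orthonormal_basis e" and ind: "indep_vars (\<lambda>_. borel) V UNIV"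
    and V: "\<And>n y. support_point M (V n) y" and W[measurable]: "W \<in> borel_measurable M"
    and sums: "AE \<omega> in M. (\<lambda>n. V n \<omega> *\<^sub>R e n) sums W \<omega>"
  shows "support_point M W y"
  unfolding support_point_def
proof safe
  fix r :: real assume r: "r > 0"
  have Vm[measurable]: "V n \<in> borel_measurable M" for n
    using ind by (auto simp: indep_vars_def2)
  have norm_e: "norm (e n) = 1" for n
    using e by (simp add: orthonormal_basis_def norm_eq_sqrt_inner)
  define a where "a n = y \<bullet> e n" for n
  \<comment> \<open>The tail is written as a functional of the coefficients, so that it is visibly a
    function of the \<open>V n\<close> with n \<ge> N and hence independent of the first N
    coefficients. The difference of W and a partial sum agrees with it only almost surely.\<close>
  define \<Phi> where "\<Phi> N p = lim (\<lambda>m. \<Sum>n\<in>{N..<m}. p n *\<^sub>R e n)" for N and p :: "nat \<Rightarrow> real"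
  define T where "T N \<omega> = \<Phi> N (\<lambda>n. V n \<omega>)" for N \<omega>
  have T: "AE \<omega> in M. \<forall>N. T N \<omega> = W \<omega> - (\<Sum>n<N. V n \<omega> *\<^sub>R e n)"
    using sums
  proof eventually_elim
    case (elim \<omega>)
    show ?case
    proof
      fix N
      have "(\<lambda>m. (\<Sum>n<m. V n \<omega> *\<^sub>R e n) - (\<Sum>n<N. V n \<omega> *\<^sub>R e n))
          \<longlonglongrightarrow> W \<omega> - (\<Sum>n<N. V n \<omega> *\<^sub>R e n)"
        using elim by (intro tendsto_diff tendsto_const) (simp add: sums_def)
      moreover have "eventually (\<lambda>m. (\<Sum>n<m. V n \<omega> *\<^sub>R e n) - (\<Sum>n<N. V n \<omega> *\<^sub>R e n) =
          (\<Sum>n\<in>{N..<m}. V n \<omega> *\<^sub>R e n)) sequentially"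
        using eventually_ge_at_top[of N]
      proof eventually_elim
        case (elim m)
        then show ?case
          using sum.atLeastLessThan_concat[of 0 N m "\<lambda>n. V n \<omega> *\<^sub>R e n"]
          by (simp add: atLeast0LessThan algebra_simps)
      qed
      ultimately have "(\<lambda>m. \<Sum>n\<in>{N..<m}. V n \<omega> *\<^sub>R e n) \<longlonglongrightarrow> W \<omega> - (\<Sum>n<N. V n \<omega> *\<^sub>R e n)"
        by (rule Lim_transform_eventually)
      then show "T N \<omega> = W \<omega> - (\<Sum>n<N. V n \<omega> *\<^sub>R e n)"
        unfolding T_def \<Phi>_def by (rule limI)
    qed
  qed
  have T_lim: "AE \<omega> in M. (\<lambda>N. T N \<omega>) \<longlonglongrightarrow> 0"
    using T sums
  proof eventually_elim
    case (elim \<omega>)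
    have "(\<lambda>N. W \<omega> - (\<Sum>n<N. V n \<omega> *\<^sub>R e n)) \<longlonglongrightarrow> W \<omega> - W \<omega>"
      using elim(2) by (intro tendsto_diff tendsto_const) (simp add: sums_def)
    then show ?case
      using elim(1) by simp
  qed
  have Tm[measurable]: "T N \<in> borel_measurable M" for N
    unfolding T_def \<Phi>_def by measurable
  have "eventually (\<lambda>N. dist (\<Sum>n<N. a n *\<^sub>R e n) y < r / 4) sequentially"
    using tendstoD[OF orthonormal_basis_expansion[OF e, of y, unfolded sums_def], of "r / 4"] r
    by (simp add: a_def)
  then obtain N0 where N0: "\<And>N. N \<ge> N0 \<Longrightarrow> dist (\<Sum>n<N. a n *\<^sub>R e n) y < r / 4"
    by (auto simp: eventually_sequentially)
  have "\<exists>N>N0. prob {\<omega> \<in> space M. T N \<omega> \<in> ball 0 (r / 4)} > 0"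
  proof (rule ccontr)
    assume "\<not> ?thesis"
    then have "AE \<omega> in M. T N \<omega> \<notin> ball 0 (r / 4)" if "N > N0" for N
    proof -
      have ev: "{\<omega> \<in> space M. T N \<omega> \<in> ball 0 (r / 4)} \<in> events"
        unfolding Collect_mem_eq_vimage by (intro measurable_sets[OF Tm]) simp
      have "prob {\<omega> \<in> space M. T N \<omega> \<in> ball 0 (r / 4)} = 0"
        using \<open>\<not> _\<close> that by (auto simp: zero_less_measure_iff)
      then have "AE \<omega> in M. \<omega> \<notin> {\<omega> \<in> space M. T N \<omega> \<in> ball 0 (r / 4)}"
        by (simp only: prob_eq_0[OF ev])
      with AE_space show ?thesis
        by eventually_elim blast
    qed
    then have "AE \<omega> in M. \<forall>N. N > N0 \<longrightarrow> T N \<omega> \<notin> ball 0 (r / 4)"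
      by (intro AE_all_countable[THEN iffD2] allI) auto
    with T_lim have "AE \<omega> in M. False"
    proof eventually_elim
      case (elim \<omega>)
      have "eventually (\<lambda>N. dist (T N \<omega>) 0 < r / 4) sequentially"
        using elim(1) r by (intro tendstoD) auto
      with eventually_gt_at_top[of N0] have "eventually (\<lambda>N. False) sequentially"
        by eventually_elim (use elim(2) in auto)
      then show ?case by simp
    qed
    then show False by simp
  qed
  then obtain N where N: "N > N0" "prob {\<omega> \<in> space M. T N \<omega> \<in> ball 0 (r / 4)} > 0"
    by auto
  \<comment> \<open>The strict \<open>N > N0\<close> makes N positive, as this quotient and the
    product formula over \<open>{..<N}\<close> require. The first N coefficients, the tail and the
    truncation of y each cost at most r / 4, so the total stays below r.\<close>
  define \<eta> where "\<eta> = r / (4 * real N)"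
  have \<eta>: "\<eta> > 0" "real N * \<eta> = r / 4"
    using r N(1) by (auto simp: \<eta>_def)
  define E1 where "E1 = {\<omega> \<in> space M. \<forall>n<N. V n \<omega> \<in> ball (a n) \<eta>}"
  define E2 where "E2 = {\<omega> \<in> space M. T N \<omega> \<in> ball 0 (r / 4)}"
  have "prob (\<Inter>n\<in>{..<N}. V n -` ball (a n) \<eta> \<inter> space M) =
      (\<Prod>n<N. prob (V n -` ball (a n) \<eta> \<inter> space M))"
    using N(1) by (intro indep_varsD[OF ind]) auto
  moreover have "(\<Inter>n\<in>{..<N}. V n -` ball (a n) \<eta> \<inter> space M) = E1"
    using N(1) by (auto simp: E1_def)
  moreover have "prob (V n -` ball (a n) \<eta> \<inter> space M) > 0" for n
    using V[of n "a n"] \<eta>(1) unfolding support_point_def Collect_mem_eq_vimage by blast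
  ultimately have E1: "prob E1 > 0"
    by (simp add: prod_pos)
  let ?P = "\<lambda>I. PiM I (\<lambda>_. borel) :: (nat \<Rightarrow> real) measure"
  define Hd where "Hd \<omega> = restrict (\<lambda>i. V i \<omega>) {..<N}" for \<omega>
  define Tl where "Tl \<omega> = restrict (\<lambda>i. V i \<omega>) {N..}" for \<omega>
  define Xa where "Xa = PiE {..<N} (\<lambda>n. ball (a n) \<eta>)"
  define Xb where "Xb = \<Phi> N -` ball 0 (r / 4) \<inter> space (?P {N..})"
  have indep: "indep_var (?P {..<N}) Hd (?P {N..}) Tl"
    unfolding Hd_def Tl_def by (intro indep_var_restrict[OF ind]) auto
  have Xa: "Xa \<in> sets (?P {..<N})"
    unfolding Xa_def by (intro sets_PiM_I_finite) auto
  have "\<Phi> N \<in> borel_measurable (?P {N..})"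
    unfolding \<Phi>_def
    by (intro borel_measurable_lim_metric borel_measurable_sum borel_measurable_scaleR
        borel_measurable_const measurable_component_singleton) auto
  then have Xb: "Xb \<in> sets (?P {N..})"
    unfolding Xb_def by (rule measurable_sets) simp
  have \<Phi>_Tl: "\<Phi> N (Tl \<omega>) = T N \<omega>" for \<omega>
    unfolding T_def \<Phi>_def Tl_def by (intro arg_cong[where f = lim] ext sum.cong refl) (simp add: restrict_def)
  have "Tl \<omega> \<in> space (?P {N..})" for \<omega>
    by (simp add: Tl_def space_PiM)
  then have E2_eq: "Tl -` Xb \<inter> space M = E2"
    unfolding Xb_def E2_def vimage_def by (simp only: Int_iff mem_Collect_eq \<Phi>_Tl) blast
  have "Hd \<omega> \<in> Xa \<longleftrightarrow> (\<forall>n<N. V n \<omega> \<in> ball (a n) \<eta>)" for \<omega>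
    by (simp only: Hd_def Xa_def restrict_PiE_iff Ball_def lessThan_iff)
  then have E1_eq: "Hd -` Xa \<inter> space M = E1"
    unfolding E1_def by blast
  have "(\<lambda>\<omega>. (Hd \<omega>, Tl \<omega>)) -` (Xa \<times> Xb) \<inter> space M = E1 \<inter> E2"
    unfolding E1_eq[symmetric] E2_eq[symmetric] by blast
  with indep_varD[OF indep Xa Xb] have "prob (E1 \<inter> E2) = prob E1 * prob E2"
    unfolding E1_eq E2_eq by simp
  with E1 N(2) have "0 < prob (E1 \<inter> E2)"
    by (simp add: E2_def)
  also have "\<dots> \<le> prob {\<omega> \<in> space M. W \<omega> \<in> ball y r}"
  proof (rule finite_measure_mono_AE)
    show "AE \<omega> in M. \<omega> \<in> E1 \<inter> E2 \<longrightarrow> \<omega> \<in> {\<omega> \<in> space M. W \<omega> \<in> ball y r}"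
      using T
    proof eventually_elim
      case (elim \<omega>)
      show ?case
      proof
        assume \<omega>: "\<omega> \<in> E1 \<inter> E2"
        have "W \<omega> - y = (\<Sum>n<N. (V n \<omega> - a n) *\<^sub>R e n) + T N \<omega> + ((\<Sum>n<N. a n *\<^sub>R e n) - y)"
          using elim by (simp add: scaleR_diff_left sum_subtractf)
        also have "norm \<dots> \<le> norm (\<Sum>n<N. (V n \<omega> - a n) *\<^sub>R e n) + norm (T N \<omega>) +
            norm ((\<Sum>n<N. a n *\<^sub>R e n) - y)"
          by (intro norm_triangle_le add_mono order_refl norm_triangle_ineq)
        also have "norm (\<Sum>n<N. (V n \<omega> - a n) *\<^sub>R e n) \<le> real N * \<eta>"
        proof -
          have "norm (\<Sum>n<N. (V n \<omega> - a n) *\<^sub>R e n) \<le> (\<Sum>n<N. \<eta>)"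
          proof (rule sum_norm_le)
            fix n assume "n \<in> {..<N}"
            then have "dist (a n) (V n \<omega>) < \<eta>"
              using \<omega> by (auto simp: E1_def)
            then show "norm ((V n \<omega> - a n) *\<^sub>R e n) \<le> \<eta>"
              by (simp add: norm_e dist_real_def abs_minus_commute)
          qed
          then show ?thesis by simp
        qed
        also have "norm (T N \<omega>) < r / 4"
          using \<omega> by (simp add: E2_def)
        also have "norm ((\<Sum>n<N. a n *\<^sub>R e n) - y) < r / 4"
          using N0[of N] N(1) by (simp add: dist_norm)
        finally have "norm (W \<omega> - y) < r"
          using r \<eta>(2) by simp
        then show "\<omega> \<in> {\<omega> \<in> space M. W \<omega> \<in> ball y r}"
          using \<omega> by (auto simp: E1_def dist_norm norm_minus_commute)
      qed
    qed
    show "{\<omega> \<in> space M. W \<omega> \<in> ball y r} \<in> events"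
      unfolding Collect_mem_eq_vimage by (intro measurable_sets[OF W]) simp
  qed
  finally show "prob {\<omega> \<in> space M. W \<omega> \<in> ball y r} > 0" .
qed

text \<open>The noise after s is assumed independent of \<open>\<F> s\<close> as a sigma-algebra;
  this turns it into independence of any two variables measurable for the two sides.\<close>

lemma indep_var_of_indep_set:
  assumes ind: "indep_set (sets A) (sets B)" and sp: "space A = space M" "space B = space M"
    and U: "U \<in> measurable A S" and V: "V \<in> measurable B T"
  shows "indep_var S U T V"
proof -
  have sub: "sets A \<subseteq> events" "sets B \<subseteq> events"
    using ind by (auto simp: indep_set_def indep_sets_def UNIV_bool)
  have gen: "sigma_sets (space M) {X -` E \<inter> space M |E. E \<in> sets R} \<subseteq> sets C"
    if "X \<in> measurable C R" "space C = space M" for X :: "'a \<Rightarrow> 'd" and C R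
    unfolding that(2)[symmetric]
    by (intro sets.sigma_sets_subset) (auto intro!: measurable_sets[OF that(1)])
  have "U \<in> measurable M S" "V \<in> measurable M T"
    using measurable_from_subalg[OF _ U] measurable_from_subalg[OF _ V] sub sp
    by (auto simp: subalgebra_def)
  moreover have "indep_set (sigma_sets (space M) {U -` E \<inter> space M |E. E \<in> sets S})
      (sigma_sets (space M) {V -` E \<inter> space M |E. E \<in> sets T})"
    using gen[OF U sp(1)] gen[OF V sp(2)] ind unfolding indep_set_def
    by (elim indep_sets_mono_sets) (auto split: bool.split)
  ultimately show ?thesis
    by (simp add: indep_var_eq)
qed

end

section \<open>Predictable processes\<close>

text \<open>A common form for both kinds of generators. \<open>I \<subseteq> {u..}\<close> encodes
  adaptedness, because a time t in I satisfies u \<le> t and A then belongs to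
  \<open>\<F> t\<close>; that I is Borel serves the measurability of paths.\<close>

lemma predictable_rectangle:
  assumes "R \<in> {{0} \<times> A | A. A \<in> sets (\<F> (0::real))} \<union>
    {{s<..t} \<times> A | s t A. 0 \<le> s \<and> s < t \<and> A \<in> sets (\<F> s)}"
  shows "\<exists>I A u. R = I \<times> A \<and> A \<in> sets (\<F> u) \<and> 0 \<le> u \<and> I \<subseteq> {u..} \<and> I \<in> sets borel"
  using assms
proof (elim UnE)
  assume "R \<in> {{0} \<times> A | A. A \<in> sets (\<F> 0)}"
  then obtain A where "R = {0} \<times> A" "A \<in> sets (\<F> 0)" by blast
  then show ?thesis
    by (intro exI[of _ "{0::real}"] exI[of _ A] exI[of _ 0]) auto
next
  assume "R \<in> {{s<..t} \<times> A | s t A. 0 \<le> s \<and> s < t \<and> A \<in> sets (\<F> s)}"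
  then obtain s t A where "R = {s<..t} \<times> A" "0 \<le> s" "A \<in> sets (\<F> s)" by blast
  then show ?thesis
    by (intro exI[of _ "{s<..t}"] exI[of _ A] exI[of _ s]) auto
qed

lemma predictable_adapted:
  assumes B: "stochastic_basis M \<F>" and X: "predictable M \<F> X" and t: "t \<ge> 0"
  shows "X t \<in> borel_measurable (\<F> t)"
proof -
  interpret stochastic_basis M \<F> by fact
  have sp: "space (\<F> u) = space M" if "u \<ge> 0" for u
    using subalgebra_\<F>[OF that] by (simp add: subalgebra_def)
  have "(\<lambda>\<omega>. (t, \<omega>)) \<in> measurable (\<F> t) (predictable_algebra M \<F>)"
    unfolding predictable_algebra_def
  proof (rule measurable_measure_of)
    let ?G = "{{0} \<times> A | A. A \<in> sets (\<F> 0)} \<union>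
      {{s<..t} \<times> A | s t A. 0 \<le> s \<and> s < t \<and> A \<in> sets (\<F> s)}"
    show "?G \<subseteq> Pow ({0..} \<times> space M)"
    proof
      fix R assume "R \<in> ?G"
      from predictable_rectangle[OF this] obtain I A u where R: "R = I \<times> A" "A \<in> sets (\<F> u)"
          "0 \<le> u" "I \<subseteq> {u..}"
        by blast
      have "A \<subseteq> space M"
        using sets.sets_into_space[OF R(2)] sp[OF R(3)] by simp
      with R show "R \<in> Pow ({0..} \<times> space M)" by auto
    qed
    show "(\<lambda>\<omega>. (t, \<omega>)) \<in> space (\<F> t) \<rightarrow> {0..} \<times> space M"
      using t sp by auto
    fix R assume "R \<in> ?G"
    from predictable_rectangle[OF this] obtain I A u where R: "R = I \<times> A" "A \<in> sets (\<F> u)"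
        "0 \<le> u" "t \<in> I \<longrightarrow> u \<le> t"
      by blast
    have "(\<lambda>\<omega>. (t, \<omega>)) -` R \<inter> space (\<F> t) = (if t \<in> I then A else {})"
      using sets.sets_into_space[OF R(2)] sp[OF R(3)] sp[OF t] by (auto simp: R(1))
    then show "(\<lambda>\<omega>. (t, \<omega>)) -` R \<inter> space (\<F> t) \<in> sets (\<F> t)"
      using R \<F>_mono[of u t] by auto
  qed
  from measurable_compose[OF this X[unfolded predictable_def]] show ?thesis
    by simp
qed

lemma predictable_path_measurable:
  assumes B: "stochastic_basis M \<F>" and X: "predictable M \<F> X" and \<omega>: "\<omega> \<in> space M"
  shows "(\<lambda>u. X u \<omega>) \<in> borel_measurable (restrict_space borel {0..})"
proof -
  interpret stochastic_basis M \<F> by fact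
  have sp: "space (\<F> u) = space M" if "u \<ge> 0" for u
    using subalgebra_\<F>[OF that] by (simp add: subalgebra_def)
  have "(\<lambda>u. (u, \<omega>)) \<in> measurable (restrict_space borel {0..}) (predictable_algebra M \<F>)"
    unfolding predictable_algebra_def
  proof (rule measurable_measure_of)
    let ?G = "{{0} \<times> A | A. A \<in> sets (\<F> 0)} \<union>
      {{s<..t} \<times> A | s t A. 0 \<le> s \<and> s < t \<and> A \<in> sets (\<F> s)}"
    show "?G \<subseteq> Pow ({0..} \<times> space M)"
    proof
      fix R assume "R \<in> ?G"
      from predictable_rectangle[OF this] obtain I A u where R: "R = I \<times> A" "A \<in> sets (\<F> u)"
          "0 \<le> u" "I \<subseteq> {u..}"
        by blast
      have "A \<subseteq> space M"
        using sets.sets_into_space[OF R(2)] sp[OF R(3)] by simp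
      with R show "R \<in> Pow ({0..} \<times> space M)" by auto
    qed
    show "(\<lambda>u. (u, \<omega>)) \<in> space (restrict_space borel {0..}) \<rightarrow> {0..} \<times> space M"
      using \<omega> by (auto simp: space_restrict_space)
    fix R assume "R \<in> ?G"
    from predictable_rectangle[OF this] obtain I A where R: "R = I \<times> A" "I \<in> sets borel"
      by blast
    have "(\<lambda>u. (u, \<omega>)) -` R \<inter> space (restrict_space borel {0..}) = (if \<omega> \<in> A then I \<inter> {0..} else {})"
      using R by (auto simp: space_restrict_space)
    then show "(\<lambda>u. (u, \<omega>)) -` R \<inter> space (restrict_space borel {0..}) \<in> sets (restrict_space borel {0..})"
      using R by (auto simp: sets_restrict_space)
  qed
  from measurable_compose[OF this X[unfolded predictable_def]] show ?thesis
    by simp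
qed

section \<open>The drift over a short time interval\<close>

text \<open>Time enters both the operator and its argument. Expanding in the eigenbasis reduces
  measurability to scalar functions of u, and contractivity bounds the integrand by K on a bounded
  interval.\<close>

lemma diagonal_convolution_integrable:
  fixes e :: "nat \<Rightarrow> 'h::{real_inner, banach, second_countable_topology}"
  assumes e: "orthonormal_basis e" and S: "\<And>\<tau>. \<tau> \<ge> 0 \<Longrightarrow> bounded_linear (S \<tau>)"
    and S_e: "\<And>\<tau> k. \<tau> \<ge> 0 \<Longrightarrow> S \<tau> (e k) = exp (- \<gamma> k * \<tau>) *\<^sub>R e k"
    and \<gamma>: "\<And>n. \<gamma> n \<ge> 0"
    and G: "G \<in> borel_measurable (restrict_space borel {0..})"
    and K: "\<And>u. norm (G u) \<le> K"
  shows "set_integrable lborel {0..t} (\<lambda>u. S (t - u) (G u))"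
proof -
  \<comment> \<open>G is known to be measurable only on nonnegative times; its extension by 0 is
    Borel on the whole line and agrees with G on [0, t].\<close>
  define H where "H u = indicator {0..} u *\<^sub>R G u" for u :: real
  have [measurable]: "H \<in> borel_measurable borel"
    using G unfolding H_def by (subst (asm) borel_measurable_restrict_space_iff) auto
  have meas: "(\<lambda>u. indicator {0..t} u *\<^sub>R S (t - u) (G u)) \<in> borel_measurable lborel"
  proof (rule borel_measurable_LIMSEQ_metric)
    fix N
    show "(\<lambda>u. \<Sum>n<N. (indicator {0..t} u * (exp (- \<gamma> n * (t - u)) * (H u \<bullet> e n))) *\<^sub>R e n) \<in> borel_measurable lborel"
      by measurable
  next
    fix u
    show "(\<lambda>N. \<Sum>n<N. (indicator {0..t} u * (exp (- \<gamma> n * (t - u)) * (H u \<bullet> e n))) *\<^sub>R e n)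
        \<longlonglongrightarrow> indicator {0..t} u *\<^sub>R S (t - u) (G u)"
    proof (cases "u \<in> {0..t}")
      case True
      then show ?thesis
        using diagonal_operator_expansion[OF e S S_e, of "t - u" "G u"] by (simp add: H_def sums_def)
    qed auto
  qed
  have "integrable lborel (\<lambda>u. indicator {0..t} u *\<^sub>R S (t - u) (G u))"
  proof (rule Bochner_Integration.integrable_bound)
    show "integrable lborel (\<lambda>u. indicator {0..t} u *\<^sub>R K)"
      by (rule integrable_scaleR_left) (auto intro!: integrable_real_indicator simp: emeasure_lborel_Icc_eq)
    have "norm (indicator {0..t} u *\<^sub>R S (t - u) (G u)) \<le> norm (indicator {0..t} u *\<^sub>R K)" for u
    proof (cases "u \<in> {0..t}")
      case True
      then have "norm (S (t - u) (G u)) \<le> norm (G u)"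
        using \<gamma> by (intro diagonal_operator_contraction[OF e S S_e]) auto
      then show ?thesis
        using True K[of u] by simp
    qed simp
    then show "AE u in lborel. norm (indicator {0..t} u *\<^sub>R S (t - u) (G u)) \<le> norm (indicator {0..t} u *\<^sub>R K)"
      by simp
  qed (rule meas)
  then show ?thesis
    by (simp add: set_integrable_def)
qed

text \<open>By the semigroup law the two integrands coincide for u \<le> s, so only the integral
  over (s, t] survives, with integrand of norm at most K.\<close>

lemma diagonal_convolution_increment:
  fixes e :: "nat \<Rightarrow> 'h::{real_inner, banach, second_countable_topology}"
  assumes e: "orthonormal_basis e" and S: "\<And>\<tau>. \<tau> \<ge> 0 \<Longrightarrow> bounded_linear (S \<tau>)"
    and S_e: "\<And>\<tau> k. \<tau> \<ge> 0 \<Longrightarrow> S \<tau> (e k) = exp (- \<gamma> k * \<tau>) *\<^sub>R e k"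
    and S_add: "\<And>\<sigma> \<tau> h. \<sigma> \<ge> 0 \<Longrightarrow> \<tau> \<ge> 0 \<Longrightarrow> S (\<sigma> + \<tau>) h = S \<sigma> (S \<tau> h)"
    and \<gamma>: "\<And>n. \<gamma> n \<ge> 0"
    and G: "G \<in> borel_measurable (restrict_space borel {0..})"
    and K: "\<And>u. norm (G u) \<le> K" and st: "0 \<le> s" "s \<le> t"
  shows "norm ((LINT u:{0..t}|lborel. S (t - u) (G u)) -
    S (t - s) (LINT u:{0..s}|lborel. S (s - u) (G u))) \<le> K * (t - s)"
proof -
  note int = diagonal_convolution_integrable[OF e S S_e \<gamma> G K, unfolded set_integrable_def]
  have lin: "bounded_linear (S (t - s))"
    using S st by simp
  have "S (t - s) (LINT u:{0..s}|lborel. S (s - u) (G u)) =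
      (LINT u|lborel. S (t - s) (indicator {0..s} u *\<^sub>R S (s - u) (G u)))"
    unfolding set_lebesgue_integral_def by (rule integral_bounded_linear[OF lin int, symmetric])
  then have "(LINT u:{0..t}|lborel. S (t - u) (G u)) -
      S (t - s) (LINT u:{0..s}|lborel. S (s - u) (G u)) =
      (LINT u|lborel. indicator {0..t} u *\<^sub>R S (t - u) (G u) -
        S (t - s) (indicator {0..s} u *\<^sub>R S (s - u) (G u)))"
    unfolding set_lebesgue_integral_def
    by (simp only: Bochner_Integration.integral_diff[OF int integrable_bounded_linear[OF lin int]])
  also have "norm \<dots> \<le> (LINT u|lborel. indicator {s<..t} u *\<^sub>R K)"
  proof (rule Bochner_Integration.integral_norm_bound_integral)
    show "integrable lborel (\<lambda>u. indicator {0..t} u *\<^sub>R S (t - u) (G u) -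
        S (t - s) (indicator {0..s} u *\<^sub>R S (s - u) (G u)))"
      by (intro Bochner_Integration.integrable_diff integrable_bounded_linear[OF lin] int)
    show "integrable lborel (\<lambda>u. indicator {s<..t} u *\<^sub>R K)"
      by (rule integrable_scaleR_left) (use st in \<open>auto intro!: integrable_real_indicator\<close>)
    fix u
    have "S (t - s) (S (s - u) (G u)) = S (t - u) (G u)" if "u \<le> s"
      using S_add[of "t - s" "s - u" "G u"] st that by simp
    moreover have "norm (S (t - u) (G u)) \<le> K" if "u \<le> t"
    proof -
      have "norm (S (t - u) (G u)) \<le> norm (G u)"
        using \<gamma> that by (intro diagonal_operator_contraction[OF e S S_e]) auto
      then show ?thesis
        using K[of u] by simp
    qed
    ultimately show "norm (indicator {0..t} u *\<^sub>R S (t - u) (G u) -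
        S (t - s) (indicator {0..s} u *\<^sub>R S (s - u) (G u))) \<le> indicator {s<..t} u *\<^sub>R K"
      using st linear_0[OF bounded_linear.linear[OF lin]] by (auto simp: indicator_def)
  qed
  also have "\<dots> = K * (t - s)"
    using st by (simp add: integral_scaleR_left integrable_real_indicator)
  finally show ?thesis .
qed

section \<open>The noise over a short time interval\<close>

text \<open>Riemann sums over [s, s + h] see only increments between times after s, which is what
  allows one path to be replaced by another with the same increments there.\<close>

lemma riemann_sum_cong:
  assumes "s \<ge> 0" "h \<ge> 0"
    and "\<And>u v. u \<ge> s \<Longrightarrow> v \<ge> s \<Longrightarrow> p u - p v = q u - q v"
  shows "riemann_sum f s h N p = riemann_sum f s h N q"
  unfolding riemann_sum_def
  by (intro sum.cong refl arg_cong2[where f = "(*)"] assms(3)) (use assms(1,2) in auto)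

lemma borel_measurable_riemann_sum:
  assumes "h \<ge> 0" and "\<And>u. u \<ge> s \<Longrightarrow> (\<lambda>\<omega>. p \<omega> u) \<in> borel_measurable M"
  shows "(\<lambda>\<omega>. riemann_sum f s h N (p \<omega>)) \<in> borel_measurable M"
  unfolding riemann_sum_def
  by (intro borel_measurable_sum borel_measurable_times borel_measurable_const
      borel_measurable_diff assms(2)) (use assms(1) in auto)

text \<open>The right-hand side
  \<open>Z\<^sub>A t \<omega> - S (t - s) (Z\<^sub>A s \<omega>)\<close> is fixed only up to null
  sets and formally involves the past, so W is built anew as a series of pathwise limits. Each
  coordinate is one functional \<Phi> n read in three ways: on the path of \<open>Z n\<close> to
  find its law, on the path restricted to nonnegative times to get independence of the coordinates,
  and on the increments after s to get measurability for the future noise.\<close>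

lemma stoch_convolution_increment:
  fixes e :: "nat \<Rightarrow> 'h::{real_inner, banach, second_countable_topology}"
  assumes B: "stochastic_basis M \<F>" and e: "orthonormal_basis e"
    and \<alpha>: "0 < \<alpha>" "\<alpha> < 2" and noise: "stable_noise M \<F> \<alpha> Z"
    and \<beta>: "\<And>n. \<beta> n > 0" and \<gamma>: "\<And>n. \<gamma> n > 0"
    and S: "\<And>\<tau>. \<tau> \<ge> 0 \<Longrightarrow> bounded_linear (S \<tau>)"
    and S_e: "\<And>\<tau> k. \<tau> \<ge> 0 \<Longrightarrow> S \<tau> (e k) = exp (- \<gamma> k * \<tau>) *\<^sub>R e k"
    and conv: "stoch_convolution M \<F> e \<beta> \<gamma> Z Z\<^sub>A" and st: "0 \<le> s" "s < t"
  shows "\<exists>W. W \<in> borel_measurable (vimage_algebra (space M)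
      (\<lambda>\<omega>. \<lambda>p\<in>UNIV \<times> {s..}. Z (fst p) (snd p) \<omega> - Z (fst p) s \<omega>)
      (PiM (UNIV \<times> {s..}) (\<lambda>_. borel))) \<and> W \<in> borel_measurable M \<and>
    (AE \<omega> in M. W \<omega> = Z\<^sub>A t \<omega> - S (t - s) (Z\<^sub>A s \<omega>)) \<and> (\<forall>y. support_point M W y)"
proof -
  interpret stochastic_basis M \<F> by fact
  define h where "h = t - s"
  have h: "h > 0" "t = s + h"
    using st by (auto simp: h_def)
  have Z: "stable_levy_process M \<alpha> (Z n)" for n
    using noise by (auto simp: stable_noise_def)
  have Zm: "Z n u \<in> borel_measurable M" if "u \<ge> 0" for n u
    using stable_levy_process_measurable[OF Z that] .
  define f where "f n u = exp (- \<gamma> n * (t - u)) * \<beta> n" for n u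
  define g where "g n u = exp (- \<gamma> n * (s - u)) * \<beta> n" for n u
  \<comment> \<open>The eigenvalue of \<open>S h\<close> at \<open>e n\<close>: it relates the two
    integrands and also appears when \<open>S h\<close> is applied to the series for
    \<open>Z\<^sub>A s\<close>.\<close>
  define c where "c n = exp (- \<gamma> n * h)" for n
  have fg: "f n u = c n * g n u" for n u
    by (simp add: f_def g_def c_def h_def exp_add[symmetric] algebra_simps)
  obtain J where J: "\<And>n. has_stoch_integral M (f n) (Z n) (s + h) (J n)"
      "AE \<omega> in M. (\<lambda>n. J n \<omega> *\<^sub>R e n) sums Z\<^sub>A t \<omega>"
    using conv st unfolding stoch_convolution_def f_def h(2)[symmetric] by (meson less_imp_le order_trans)
  obtain K where K: "\<And>n. has_stoch_integral M (g n) (Z n) s (K n)"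
      "AE \<omega> in M. (\<lambda>n. K n \<omega> *\<^sub>R e n) sums Z\<^sub>A s \<omega>"
    using conv st unfolding stoch_convolution_def g_def by meson
  have JK: "J n \<in> borel_measurable M" "K n \<in> borel_measurable M" for n
    using J(1)[of n] K(1)[of n] by (auto simp: has_stoch_integral_def)
  have Rm: "(\<lambda>\<omega>. riemann_sum (f n) s h N (\<lambda>u. Z n u \<omega>)) \<in> borel_measurable M" for n N
    using st h by (intro borel_measurable_riemann_sum Zm) auto
  have "\<exists>r::nat \<Rightarrow> nat. AE \<omega> in M.
      (\<lambda>k. riemann_sum (f n) s h (r k) (\<lambda>u. Z n u \<omega>)) \<longlonglongrightarrow> J n \<omega> - c n * K n \<omega>" for n
  proof (rule AE_convergent_subsequence)
    show "(\<lambda>\<omega>. J n \<omega> - c n * K n \<omega>) \<in> borel_measurable M"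
      using JK by (intro borel_measurable_diff borel_measurable_times) auto
    fix \<epsilon> \<eta> :: real assume "\<epsilon> > 0" "\<eta> > 0"
    then show "eventually (\<lambda>N. prob {\<omega> \<in> space M. \<bar>riemann_sum (f n) s h N (\<lambda>u. Z n u \<omega>) -
        (J n \<omega> - c n * K n \<omega>)\<bar> > \<epsilon>} < \<eta>) sequentially"
      by (intro riemann_sum_tendsto_in_prob[OF J(1) K(1) fg st(1) h(1) Zm])
  qed (rule Rm)
  then obtain r :: "nat \<Rightarrow> nat \<Rightarrow> nat" where r: "\<And>n. AE \<omega> in M.
      (\<lambda>k. riemann_sum (f n) s h (r n k) (\<lambda>u. Z n u \<omega>)) \<longlonglongrightarrow> J n \<omega> - c n * K n \<omega>"
    by metis
  \<comment> \<open>On paths where the sums diverge \<open>lim\<close> takes some unspecified value;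
    this happens with probability 0 for the paths of \<open>Z n\<close>, and measurability holds
    regardless.\<close>
  define \<Phi> where "\<Phi> n p = lim (\<lambda>k. riemann_sum (f n) s h (r n k) p)" for n and p :: "real \<Rightarrow> real"
  have \<Phi>_cong: "\<Phi> n p = \<Phi> n q" if "\<And>u v. u \<ge> s \<Longrightarrow> v \<ge> s \<Longrightarrow> p u - p v = q u - q v" for n p q
    unfolding \<Phi>_def using st h that by (intro arg_cong[where f = lim] ext riemann_sum_cong) auto
  have \<Phi>_meas: "(\<lambda>x. \<Phi> n (p x)) \<in> borel_measurable C"
    if "\<And>u. u \<ge> s \<Longrightarrow> (\<lambda>x. p x u) \<in> borel_measurable C" for n p and C :: "'z measure"
    unfolding \<Phi>_def using h that by (intro borel_measurable_lim_metric borel_measurable_riemann_sum) auto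
  define V where "V n \<omega> = \<Phi> n (\<lambda>u. Z n u \<omega>)" for n \<omega>
  have V_eq: "AE \<omega> in M. V n \<omega> = J n \<omega> - c n * K n \<omega>" for n
    using r[of n] unfolding V_def \<Phi>_def by eventually_elim (rule limI)
  have Vm: "V n \<in> borel_measurable M" for n
    unfolding V_def using st by (intro \<Phi>_meas Zm) auto
  have V_supp: "support_point M (V n) y" for n y
  proof -
    have "\<exists>a>0. distr M borel (V n) = distr M borel (Z n a)"
    proof (rule stable_riemann_limit_distr[OF Z \<alpha>(1) st(1) h(1) _ _ Vm])
      fix u assume u: "s \<le> u" "u \<le> s + h"
      have "\<gamma> n * (t - u) \<le> \<gamma> n * h" "0 \<le> \<gamma> n * (t - u)"
        using u \<gamma>[of n] h by (auto intro!: mult_left_mono)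
      then show "c n * \<beta> n \<le> f n u \<and> f n u \<le> \<beta> n"
        using \<beta>[of n] by (simp add: f_def c_def)
    next
      show "c n * \<beta> n > 0"
        using \<beta> by (simp add: c_def)
      show "AE \<omega> in M. (\<lambda>k. riemann_sum (f n) s h (r n k) (\<lambda>u. Z n u \<omega>)) \<longlonglongrightarrow> V n \<omega>"
        using r[of n] V_eq[of n] by eventually_elim simp
    qed
    then obtain a where a: "a > 0" "distr M borel (V n) = distr M borel (Z n a)"
      by blast
    then show ?thesis
      using support_point_distr_cong[OF Zm Vm a(2)[symmetric] stable_full_support[OF Z \<alpha> a(1)]] by simp
  qed
  have V_indep: "indep_vars (\<lambda>_. borel) V UNIV"
  proof -
    have "indep_vars (\<lambda>_. PiM {0..} (\<lambda>_. borel)) (\<lambda>n \<omega>. \<lambda>u\<in>{0..}. Z n u \<omega>) UNIV"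
      using noise by (simp add: stable_noise_def)
    then have "indep_vars (\<lambda>_. borel) (\<lambda>n \<omega>. \<Phi> n (\<lambda>u\<in>{0..}. Z n u \<omega>)) UNIV"
      by (rule indep_vars_compose2) (use st in \<open>auto intro!: \<Phi>_meas measurable_component_singleton\<close>)
    moreover have "\<Phi> n (\<lambda>u\<in>{0..}. Z n u \<omega>) = V n \<omega>" for n \<omega>
      unfolding V_def using st by (intro \<Phi>_cong) auto
    ultimately show ?thesis
      by (simp add: fun_eq_iff[symmetric])
  qed
  define W where "W \<omega> = (\<Sum>n. V n \<omega> *\<^sub>R e n)" for \<omega>
  have "AE \<omega> in M. \<forall>n. V n \<omega> = J n \<omega> - c n * K n \<omega>"
    using V_eq by (simp add: AE_all_countable)
  with J(2) K(2) have sums: "AE \<omega> in M. (\<lambda>n. V n \<omega> *\<^sub>R e n) sums (Z\<^sub>A t \<omega> - S (t - s) (Z\<^sub>A s \<omega>))"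
  proof eventually_elim
    case (elim \<omega>)
    have lin: "bounded_linear (S h)"
      using S h by simp
    have "S h (K n \<omega> *\<^sub>R e n) = (c n * K n \<omega>) *\<^sub>R e n" for n
      using h by (subst linear_simps(5)[OF lin]) (simp add: S_e c_def mult.commute)
    with bounded_linear.sums[OF lin elim(2)] have "(\<lambda>n. (c n * K n \<omega>) *\<^sub>R e n) sums S h (Z\<^sub>A s \<omega>)"
      by simp
    from sums_diff[OF elim(1) this] show ?case
      using elim(3) by (simp add: scaleR_diff_left h_def)
  qed
  have W_eq: "AE \<omega> in M. W \<omega> = Z\<^sub>A t \<omega> - S (t - s) (Z\<^sub>A s \<omega>)"
    using sums unfolding W_def by eventually_elim (rule sums_unique[symmetric])
  have Wm: "W \<in> borel_measurable M"
    unfolding W_def by (intro borel_measurable_suminf borel_measurable_scaleR Vm) auto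
  have "AE \<omega> in M. (\<lambda>n. V n \<omega> *\<^sub>R e n) sums W \<omega>"
    using sums W_eq by eventually_elim simp
  then have supp: "support_point M W y" for y
    by (rule support_point_orthonormal_series[OF e V_indep V_supp Wm])
  define \<xi> where "\<xi> \<omega> = (\<lambda>p\<in>UNIV \<times> {s..}. Z (fst p) (snd p) \<omega> - Z (fst p) s \<omega>)" for \<omega>
  define C where "C = vimage_algebra (space M) \<xi> (PiM (UNIV \<times> {s..}) (\<lambda>_. borel :: real measure))"
  have \<xi>: "\<xi> \<in> measurable C (PiM (UNIV \<times> {s..}) (\<lambda>_. borel :: real measure))"
    unfolding C_def by (rule measurable_vimage_algebra1) (auto simp: \<xi>_def space_PiM)
  have "(\<lambda>\<omega>. \<xi> \<omega> (n, u)) \<in> borel_measurable C" if "u \<ge> s" for n u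
    using that by (intro measurable_compose[OF \<xi> measurable_component_singleton]) auto
  then have "(\<lambda>\<omega>. \<Phi> n (\<lambda>u. \<xi> \<omega> (n, u))) \<in> borel_measurable C" for n
    by (rule \<Phi>_meas)
  moreover have "\<Phi> n (\<lambda>u. \<xi> \<omega> (n, u)) = V n \<omega>" for n \<omega>
    unfolding V_def by (intro \<Phi>_cong) (auto simp: \<xi>_def)
  ultimately have "V n \<in> borel_measurable C" for n
    by (simp add: fun_eq_iff[symmetric])
  then have "W \<in> borel_measurable C"
    unfolding W_def by (intro borel_measurable_suminf borel_measurable_scaleR) auto
  with Wm W_eq supp show ?thesis
    unfolding C_def \<xi>_def by blast
qed

section \<open>Irreducibility of the mild solution\<close>

theorem theorem5p5:
  fixes M :: "'w measure"
    and \<F> :: "real \<Rightarrow> 'w measure"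
    and e :: "nat \<Rightarrow> 'h::{real_inner, banach, second_countable_topology}"
    and \<alpha> :: real
    and \<beta> \<gamma> :: "nat \<Rightarrow> real"
    and Z :: "nat \<Rightarrow> real \<Rightarrow> 'w \<Rightarrow> real"
    and D :: "'h set"
    and A :: "'h \<Rightarrow> 'h"
    and S :: "real \<Rightarrow> 'h \<Rightarrow> 'h"
    and F :: "'h \<Rightarrow> 'h"
    and Z\<^sub>A X :: "real \<Rightarrow> 'w \<Rightarrow> 'h"
    and x :: 'h
  assumes "orthonormal_basis e"
    and "0 < \<alpha>" "\<alpha> < 2"
    and "stochastic_basis M \<F>"
    and "stable_noise M \<F> \<alpha> Z"
    and "\<And>n. \<beta> n > 0"
    and "self_adjoint D A"
    and "\<And>n. e n \<in> D" "\<And>n. A (e n) = - \<gamma> n *\<^sub>R e n"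
    and "\<And>n. \<gamma> n > 0" "filterlim \<gamma> at_top sequentially"
    and "generates_semigroup D A S"
    and "\<And>t k. t \<ge> 0 \<Longrightarrow> S t (e k) = exp (- \<gamma> k * t) *\<^sub>R e k"
    and "summable (\<lambda>n. \<beta> n powr \<alpha> / \<gamma> n)"
    and "\<exists>L. L-lipschitz_on UNIV F" "bounded (range F)"
    and "stoch_convolution M \<F> e \<beta> \<gamma> Z Z\<^sub>A"
    and "mild_solution M \<F> S F Z\<^sub>A x X"
  shows "irreducible_process M X"
  unfolding irreducible_process_def
proof (intro allI impI)
  fix t r :: real and y :: 'h
  assume t: "t > 0" and r: "r > 0"
  interpret stochastic_basis M \<F> by fact
  note e = assms(1) and S_e = assms(13) and \<gamma> = assms(10)
  have S: "\<And>\<tau>. \<tau> \<ge> 0 \<Longrightarrow> bounded_linear (S \<tau>)"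
    and S_add: "\<And>\<sigma> \<tau> h. \<sigma> \<ge> 0 \<Longrightarrow> \<tau> \<ge> 0 \<Longrightarrow> S (\<sigma> + \<tau>) h = S \<sigma> (S \<tau> h)"
    using assms(12) by (auto simp: generates_semigroup_def C0_semigroup_def)
  have X: "predictable M \<F> X"
    and mild: "\<And>t. t \<ge> 0 \<Longrightarrow> AE \<omega> in M.
      X t \<omega> = S t x + (LINT u:{0..t}|lborel. S (t - u) (F (X u \<omega>))) + Z\<^sub>A t \<omega>"
    using assms(18) by (auto simp: mild_solution_def)
  obtain L where L: "L-lipschitz_on UNIV F"
    using assms(15) by blast
  have F_meas[measurable]: "F \<in> borel_measurable borel"
    using lipschitz_on_continuous_on[OF L] by (rule borel_measurable_continuous_onI)
  obtain K where K: "K > 0" "\<And>z. norm (F z) \<le> K"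
    using assms(16) by (auto simp: bounded_pos)
  \<comment> \<open>The bound t / 2 keeps s nonnegative, and r / (4 K) limits the drift over the
    last interval to r / 4, below the r / 2 left beside the ball around y.\<close>
  define \<epsilon> where "\<epsilon> = min (t / 2) (r / (4 * K))"
  define s where "s = t - \<epsilon>"
  have s: "0 \<le> s" "s < t" "t - s = \<epsilon>"
    using t r K(1) by (auto simp: \<epsilon>_def s_def min_def)
  have \<epsilon>: "\<epsilon> \<ge> 0" "K * \<epsilon> < r / 2"
  proof -
    have "K * \<epsilon> \<le> K * (r / (4 * K))"
      unfolding \<epsilon>_def using K(1) by (intro mult_left_mono) auto
    then show "K * \<epsilon> < r / 2"
      using K(1) r by simp
  qed (use s in auto)
  obtain W where W: "W \<in> borel_measurable (vimage_algebra (space M)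
        (\<lambda>\<omega>. \<lambda>p\<in>UNIV \<times> {s..}. Z (fst p) (snd p) \<omega> - Z (fst p) s \<omega>)
        (PiM (UNIV \<times> {s..}) (\<lambda>_. borel)))"
      "AE \<omega> in M. W \<omega> = Z\<^sub>A t \<omega> - S (t - s) (Z\<^sub>A s \<omega>)" "\<And>y. support_point M W y"
      and Wm: "W \<in> borel_measurable M"
    using stoch_convolution_increment[OF assms(4) e assms(2,3,5,6) \<gamma> S S_e assms(17) s(1,2)] by blast
  have S_cont: "S \<epsilon> \<in> borel_measurable borel"
    by (intro borel_measurable_continuous_onI linear_continuous_on S \<epsilon>)
  \<comment> \<open>U contains the initial value, the drift and the noise up to time s, all
    transported to time t; it is measurable for \<open>\<F> s\<close>.\<close>
  define U where "U \<omega> = S \<epsilon> (X s \<omega>)" for \<omega>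
  have U: "U \<in> borel_measurable (\<F> s)"
    unfolding U_def by (rule measurable_compose[OF predictable_adapted[OF assms(4) X s(1)] S_cont])
  have Um: "U \<in> borel_measurable M"
    by (rule measurable_from_subalg[OF subalgebra_\<F>[OF s(1)] U])
  have Xm: "X t \<in> borel_measurable M"
    using t by (intro measurable_from_subalg[OF subalgebra_\<F> predictable_adapted[OF assms(4) X]]) auto
  have sp: "space (\<F> s) = space M"
    using subalgebra_\<F>[OF s(1)] by (simp add: subalgebra_def)
  have "indep_var borel U borel W"
    using assms(5) s(1) by (intro indep_var_of_indep_set[OF _ sp _ U W(1)]) (auto simp: stable_noise_def)
  moreover obtain z where "support_point M U z"
    using ex_support_point[OF Um open_UNIV] by (auto simp: prob_space)
  ultimately have "support_point M (\<lambda>\<omega>. U \<omega> + W \<omega>) (z + (y - z))"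
    by (intro support_point_add W(3))
  then have "0 < prob {\<omega> \<in> space M. U \<omega> + W \<omega> \<in> ball y (r / 2)}"
    using r by (simp add: support_point_def del: mem_ball)
  also have "\<dots> \<le> prob {\<omega> \<in> space M. X t \<omega> \<in> ball y r}"
  proof (rule finite_measure_mono_AE)
    show "{\<omega> \<in> space M. X t \<omega> \<in> ball y r} \<in> events"
      unfolding Collect_mem_eq_vimage by (intro measurable_sets[OF Xm]) simp
    show "AE \<omega> in M. \<omega> \<in> {\<omega> \<in> space M. U \<omega> + W \<omega> \<in> ball y (r / 2)} \<longrightarrow>
        \<omega> \<in> {\<omega> \<in> space M. X t \<omega> \<in> ball y r}"
      \<comment> \<open>The mild equation holds almost surely at each fixed time, with an
        exceptional set depending on that time; it is invoked only at t and s.\<close>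
      using mild[OF less_imp_le[OF t]] mild[OF s(1)] W(2) AE_space
    proof eventually_elim
      case (elim \<omega>)
      let ?I = "\<lambda>t. LINT u:{0..t}|lborel. S (t - u) (F (X u \<omega>))"
      have "norm (?I t - S (t - s) (?I s)) \<le> K * (t - s)"
      proof (rule diagonal_convolution_increment[OF e S S_e S_add])
        show "(\<lambda>u. F (X u \<omega>)) \<in> borel_measurable (restrict_space borel {0..})"
          by (rule measurable_compose[OF predictable_path_measurable[OF assms(4) X elim(4)] F_meas])
      qed (use \<gamma> K s in \<open>auto intro: less_imp_le\<close>)
      \<comment> \<open>Applying \<open>S \<epsilon>\<close> to the mild equation at s, the initial
        values cancel by the semigroup law and the noise terms by the choice of W, leaving only the
        drift integrals.\<close>
      moreover have "X t \<omega> - (U \<omega> + W \<omega>) = ?I t - S (t - s) (?I s)"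
      proof -
        have lin: "bounded_linear (S \<epsilon>)"
          using S \<epsilon> by simp
        have "t = \<epsilon> + s"
          using s(3) by simp
        then have "S t x = S \<epsilon> (S s x)"
          using S_add[OF \<epsilon>(1) s(1), of x] by simp
        then have "U \<omega> = S t x + S \<epsilon> (?I s) + S \<epsilon> (Z\<^sub>A s \<omega>)"
          unfolding U_def elim(2) by (simp add: linear_simps(1)[OF lin])
        then show ?thesis
          unfolding elim(1,3) s(3) by simp
      qed
      ultimately have close: "norm (X t \<omega> - (U \<omega> + W \<omega>)) < r / 2"
        using \<epsilon>(2) s(3) by simp
      show ?case
      proof
        assume "\<omega> \<in> {\<omega> \<in> space M. U \<omega> + W \<omega> \<in> ball y (r / 2)}"
        then have "dist y (U \<omega> + W \<omega>) < r / 2"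
          by simp
        moreover have "dist y (X t \<omega>) \<le> dist y (U \<omega> + W \<omega>) + dist (U \<omega> + W \<omega>) (X t \<omega>)"
          by (rule dist_triangle)
        ultimately show "\<omega> \<in> {\<omega> \<in> space M. X t \<omega> \<in> ball y r}"
          using close elim(4) by (simp add: dist_norm norm_minus_commute)
      qed
    qed
  qed
  finally show "prob {\<omega> \<in> space M. X t \<omega> \<in> ball y r} > 0" .
qed

end
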